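(* Let $k\geq 3$ be an integer. For a Dirichlet character $\chi$ modulo $k$ let $L(s,\chi)=\sum_{n=1}^{\infty}\chi(n)n^{-s}$ ($\operatorname{Re}s>1$). Then $$\sum_{\substack{\chi \bmod k\\ \chi(-1)=-1}}|L(3,\chi)|^2=\frac{\pi^6}{90k^6}\,\phi(k)\left(\frac{J_6(k)}{21}-J_2(k)\right),$$ where the sum runs over all odd Dirichlet characters modulo $k$.
   Context: $\phi$ is Euler's totient function. For a positive integer $s$, the Jordan totient function is $J_s(n)=n^s\prod_{p\mid n,\ p\text{ prime}}\left(1-p^{-s}\right)$. A Dirichlet character $\chi$ is odd if $\chi(-1)=-1$. *)

theory Defs
  imports "HOL-Analysis.Analysis" "HOL-Number_Theory.Number_Theory"
begin

text \<open>Dirichlet characters modulo \<open>k\<close> are taken as functions on all integers (extended by zero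
  outside the units), so that \<open>\<psi> (-1)\<close> has its literal meaning.\<close>

definition dirichlet_character :: "nat \<Rightarrow> (int \<Rightarrow> complex) \<Rightarrow> bool" where
  "dirichlet_character k \<psi> \<longleftrightarrow>
     (\<forall>n. \<psi> (n + int k) = \<psi> n) \<and>
     (\<forall>m n. \<psi> (m * n) = \<psi> m * \<psi> n) \<and>
     (\<forall>n. \<psi> n \<noteq> 0 \<longleftrightarrow> coprime n (int k))"

definition odd_dirichlet_characters :: "nat \<Rightarrow> (int \<Rightarrow> complex) set" where
  "odd_dirichlet_characters k = {\<psi>. dirichlet_character k \<psi> \<and> \<psi> (- 1) = - 1}"

text \<open>The series converges absolutely for \<open>Re s > 1\<close>; outside that half-plane this is not the
  analytic continuation and should not be used.\<close>

definition dirichlet_L :: "complex \<Rightarrow> (int \<Rightarrow> complex) \<Rightarrow> complex" where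
  "dirichlet_L s \<psi> = (\<Sum>n. \<psi> (int (Suc n)) * of_nat (Suc n) powr (- s))"

definition jordan_totient :: "nat \<Rightarrow> nat \<Rightarrow> real" where
  "jordan_totient s n = real n ^ s * (\<Prod>p\<in>prime_factors n. 1 - 1 / real p ^ s)"

text \<open>The sum over all odd characters is a genuine finite sum, not the default value of
  a sum over an infinite set.\<close>

lemma dirichlet_character_mod:
  assumes "dirichlet_character k \<psi>"
  shows "\<psi> (n mod int k) = \<psi> n"
proof -
  have per: "\<psi> (m + int k) = \<psi> m" for m
    using assms by (simp add: dirichlet_character_def)
  have nat: "\<psi> (m + int j * int k) = \<psi> m" for m j
  proof (induction j)
    case (Suc j)
    have "m + int (Suc j) * int k = (m + int j * int k) + int k"
      by (simp add: algebra_simps)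
    then show ?case using per Suc.IH by metis
  qed simp
  have n: "n = n mod int k + (n div int k) * int k" by simp
  show ?thesis
  proof (cases "n div int k \<ge> 0")
    case True
    then show ?thesis using nat[of "n mod int k" "nat (n div int k)"] n by simp
  next
    case False
    then have "n mod int k = n + int (nat (- (n div int k))) * int k"
      using n by (simp add: algebra_simps)
    then show ?thesis using nat by metis
  qed
qed

lemma dirichlet_character_root_of_unity:
  assumes \<psi>: "dirichlet_character k \<psi>" and n: "coprime n (int k)" and k: "k > 0"
  shows "\<psi> n ^ totient k = 1"
proof -
  have mult: "\<psi> (a * b) = \<psi> a * \<psi> b" for a b
    using \<psi> by (simp add: dirichlet_character_def)
  have "\<psi> 1 \<noteq> 0" using \<psi> by (simp add: dirichlet_character_def)
  then have one: "\<psi> 1 = 1" using mult[of 1 1] by simp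
  have pow: "\<psi> (a ^ j) = \<psi> a ^ j" for a j
    by (induction j) (simp_all add: one mult)
  define m where "m = nat (n mod int k)"
  have m: "int m = n mod int k" using k by (simp add: m_def)
  have "coprime (int m) (int k)" using n k by (simp add: m)
  then have "coprime m k" by simp
  then have "[m ^ totient k = 1] (mod k)" by (rule euler_theorem)
  then have "int m ^ totient k mod int k = 1 mod int k"
    by (metis cong_def of_nat_1 of_nat_mod of_nat_power)
  then have "\<psi> (int m ^ totient k) = \<psi> 1"
    using dirichlet_character_mod[OF \<psi>] by metis
  then show ?thesis
    using dirichlet_character_mod[OF \<psi>, of n] by (simp add: pow one m)
qed

lemma finite_odd_dirichlet_characters:
  assumes "k > 0"
  shows "finite (odd_dirichlet_characters k)"
proof -
  let ?D = "{\<psi>. dirichlet_character k \<psi>}"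
  let ?R = "insert 0 {z::complex. z ^ totient k = 1}"
  let ?f = "\<lambda>\<psi>::int \<Rightarrow> complex. restrict \<psi> {0..<int k}"
  have "finite {z::complex. z ^ totient k = 1}"
    using assms by (intro finite_roots_unity) (simp add: Suc_le_eq)
  then have fin: "finite ({0..<int k} \<rightarrow>\<^sub>E ?R)" by (intro finite_PiE) auto
  have "\<psi> n \<in> ?R" if "dirichlet_character k \<psi>" for \<psi> n
    using dirichlet_character_root_of_unity[OF that _ assms] that
    unfolding dirichlet_character_def by blast
  then have sub: "?f ` ?D \<subseteq> {0..<int k} \<rightarrow>\<^sub>E ?R" by (intro image_subsetI restrict_PiE_iff[THEN iffD2] ballI) blast
  have "inj_on ?f ?D"
  proof (rule inj_onI, rule ext)
    fix \<psi> \<rho> n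
    assume *: "\<psi> \<in> ?D" "\<rho> \<in> ?D" "?f \<psi> = ?f \<rho>"
    have "n mod int k \<in> {0..<int k}" using assms by simp
    then have "\<psi> (n mod int k) = \<rho> (n mod int k)"
      using fun_cong[OF *(3), of "n mod int k"] by simp
    then show "\<psi> n = \<rho> n" using * dirichlet_character_mod by (metis mem_Collect_eq)
  qed
  then have "finite ?D" using fin sub by (metis finite_imageD finite_subset)
  then show ?thesis by (rule rev_finite_subset) (auto simp: odd_dirichlet_characters_def)
qed

end

theory Submission imports Defs begin

text \<open>
  Splitting the series of \<open>L(3, \<psi>)\<close> into residue classes and pairing \<open>a\<close> with \<open>k - a\<close>, the second
  derivative of the digamma reflection formula gives, with \<open>w x = cos (\<pi> x) / sin (\<pi> x) ^ 3\<close>,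
  \<open>L(3, \<psi>) = \<pi>^3 / (2 k^3) * (\<Sum>a. \<psi> a * w (a / k))\<close> for odd \<open>\<psi>\<close>, the sum being over the
  totatives of \<open>k\<close>. Orthogonality of the odd characters turns the sum over \<open>\<psi>\<close> into
  \<open>\<pi>^6 / (4 k^6) * \<phi> k * (\<Sum>a. w (a / k)^2)\<close>.

  Over all residues, \<open>w (a / n)\<close> is up to a constant the finite Fourier transform of the cubic
  \<open>j (2 j - n) (j - n)\<close>, so Parseval evaluates \<open>\<Sum>a\<le>n. w (a / n)^2\<close> as a combination of
  \<open>n^6 - 1\<close> and \<open>n^2 - 1\<close>; as \<open>\<Sum>d | n. J_s d = n^s\<close>, sorting the fractions \<open>a / n\<close> by their
  reduced denominators replaces these by \<open>J_6\<close> and \<open>J_2\<close>.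
\<close>

subsection \<open>Reflection formulas for polygamma functions\<close>

text \<open>Differentiates an identity known only on an open set. Each of the three polygamma
  formulas below arises from the formula before it by differentiating both sides on the interval (0,
  1).\<close>

lemma DERIV_unique_open:
  fixes f g :: "real \<Rightarrow> real"
  assumes "open S" "x \<in> S" "\<And>y. y \<in> S \<Longrightarrow> f y = g y"
    and "(f has_real_derivative D) (at x)" "(g has_real_derivative E) (at x)"
  shows "D = E"
  using DERIV_unique has_field_derivative_transform_within_open assms by metis

text \<open>Integers are covered by default values: there one of the two \<open>Gamma\<close>
  arguments is a pole, where \<open>Gamma\<close> is 0, and division by
  \<open>sin (pi * x) = 0\<close> gives 0 as well.\<close>

lemma Gamma_reflection_real:
  fixes x :: real
  shows "Gamma x * Gamma (1 - x) = pi / sin (pi * x)"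
proof -
  have "complex_of_real (Gamma x * Gamma (1 - x)) = Gamma (of_real x) * Gamma (of_real (1 - x))"
    by (simp only: Gamma_complex_of_real of_real_mult)
  also have "\<dots> = of_real pi / sin (of_real (pi * x))"
    using Gamma_reflection_complex[of "of_real x"] by simp
  also have "\<dots> = complex_of_real (pi / sin (pi * x))"
    by (simp only: sin_of_real of_real_divide)
  finally have "complex_of_real (Gamma x * Gamma (1 - x)) = complex_of_real (pi / sin (pi * x))" .
  then show ?thesis
    by (simp only: of_real_eq_iff)
qed

lemma sin_pi_unit_pos:
  fixes x :: real
  assumes "0 < x" "x < 1"
  shows "sin (pi * x) > 0"
  using assms by (intro sin_gt_zero) auto

lemma Digamma_reflection_real:
  fixes x :: real
  assumes x: "0 < x" "x < 1"
  shows "Digamma (1 - x) - Digamma x = pi * cos (pi * x) / sin (pi * x)"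
proof -
  note s = sin_pi_unit_pos[OF x]
  have nz: "x \<notin> \<int>\<^sub>\<le>\<^sub>0" "1 - x \<notin> \<int>\<^sub>\<le>\<^sub>0"
    using x by (auto elim!: nonpos_Ints_cases)
  have "Gamma x * Digamma x * Gamma (1 - x) - Gamma x * (Gamma (1 - x) * Digamma (1 - x)) =
        - (pi * (cos (pi * x) * pi)) / (sin (pi * x))\<^sup>2"
  proof (rule DERIV_unique_open[of "{0<..<1}" x "\<lambda>x. Gamma x * Gamma (1 - x)" "\<lambda>x. pi / sin (pi * x)"])
    show "((\<lambda>x. Gamma x * Gamma (1 - x)) has_real_derivative
        Gamma x * Digamma x * Gamma (1 - x) - Gamma x * (Gamma (1 - x) * Digamma (1 - x))) (at x)"
      using nz by (auto intro!: derivative_eq_intros)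
    show "((\<lambda>x. pi / sin (pi * x)) has_real_derivative
        - (pi * (cos (pi * x) * pi)) / (sin (pi * x))\<^sup>2) (at x)"
      using s by (auto intro!: derivative_eq_intros simp: power2_eq_square)
  qed (use x in \<open>auto simp: Gamma_reflection_real\<close>)
  \<comment> \<open>Factoring out \<open>Gamma x * Gamma (1 - x)\<close> lets the Gamma reflection
    formula apply again, so that only the nonzero factor \<open>pi / sin (pi * x)\<close> has to be
    cancelled.\<close>
  moreover have "Gamma x * Digamma x * Gamma (1 - x) - Gamma x * (Gamma (1 - x) * Digamma (1 - x)) =
      Gamma x * Gamma (1 - x) * (Digamma x - Digamma (1 - x))"
    by (simp add: algebra_simps)
  ultimately have "pi / sin (pi * x) * (Digamma x - Digamma (1 - x)) =
      - (pi * (cos (pi * x) * pi)) / (sin (pi * x))\<^sup>2"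
    by (simp only: Gamma_reflection_real)
  then have "(pi / sin (pi * x)) * (Digamma x - Digamma (1 - x)) =
      (pi / sin (pi * x)) * (- (pi * cos (pi * x) / sin (pi * x)))"
    by (simp add: power2_eq_square mult_ac)
  then have "Digamma x - Digamma (1 - x) = - (pi * cos (pi * x) / sin (pi * x))"
    using s by (subst (asm) mult_left_cancel) auto
  then show ?thesis by simp
qed

lemma Polygamma_1_reflection_real:
  fixes x :: real
  assumes x: "0 < x" "x < 1"
  shows "Polygamma 1 (1 - x) + Polygamma 1 x = pi\<^sup>2 / (sin (pi * x))\<^sup>2"
proof -
  note s = sin_pi_unit_pos[OF x]
  have nz: "x \<notin> \<int>\<^sub>\<le>\<^sub>0" "1 - x \<notin> \<int>\<^sub>\<le>\<^sub>0"
    using x by (auto elim!: nonpos_Ints_cases)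
  have "- Polygamma 1 (1 - x) - Polygamma 1 x = - pi\<^sup>2 / (sin (pi * x))\<^sup>2"
  proof (rule DERIV_unique_open[of "{0<..<1}" x "\<lambda>x. Digamma (1 - x) - Digamma x"
        "\<lambda>x. pi * cos (pi * x) / sin (pi * x)"])
    show "((\<lambda>x. Digamma (1 - x) - Digamma x) has_real_derivative
        - Polygamma 1 (1 - x) - Polygamma 1 x) (at x)"
      using nz by (auto intro!: derivative_eq_intros)
    have "- (p * s * p) * s - p * c * (c * p) = - (p\<^sup>2 * (s\<^sup>2 + c\<^sup>2))" for p s c :: real
      by (simp add: algebra_simps power2_eq_square)
    then have "- (pi * sin (pi * x) * pi) * sin (pi * x) - pi * cos (pi * x) * (cos (pi * x) * pi) =
      - (pi\<^sup>2 * ((sin (pi * x))\<^sup>2 + (cos (pi * x))\<^sup>2))"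
      .
    also have "\<dots> = - pi\<^sup>2" by simp
    finally have num: "- (pi * sin (pi * x) * pi) * sin (pi * x) -
        pi * cos (pi * x) * (cos (pi * x) * pi) = - pi\<^sup>2" .
    have "((\<lambda>x. pi * cos (pi * x) / sin (pi * x)) has_real_derivative
        (- (pi * sin (pi * x) * pi) * sin (pi * x) - pi * cos (pi * x) * (cos (pi * x) * pi)) /
          (sin (pi * x) * sin (pi * x))) (at x)"
      using s by (auto intro!: derivative_eq_intros)
    then show "((\<lambda>x. pi * cos (pi * x) / sin (pi * x)) has_real_derivative
        - pi\<^sup>2 / (sin (pi * x))\<^sup>2) (at x)"
      unfolding num by (simp add: power2_eq_square)
  qed (use x Digamma_reflection_real in auto)
  then show ?thesis by (simp add: field_simps)
qed

lemma Polygamma_2_reflection_real: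
  fixes x :: real
  assumes x: "0 < x" "x < 1"
  shows "Polygamma 2 (1 - x) - Polygamma 2 x = 2 * pi ^ 3 * cos (pi * x) / sin (pi * x) ^ 3"
proof -
  note s = sin_pi_unit_pos[OF x]
  have nz: "x \<notin> \<int>\<^sub>\<le>\<^sub>0" "1 - x \<notin> \<int>\<^sub>\<le>\<^sub>0"
    using x by (auto elim!: nonpos_Ints_cases)
  have "- Polygamma 2 (1 - x) + Polygamma 2 x = - (2 * pi ^ 3 * cos (pi * x) / sin (pi * x) ^ 3)"
  proof (rule DERIV_unique_open[of "{0<..<1}" x "\<lambda>x. Polygamma 1 (1 - x) + Polygamma 1 x"
        "\<lambda>x. pi\<^sup>2 / (sin (pi * x))\<^sup>2"])
    show "((\<lambda>x. Polygamma 1 (1 - x) + Polygamma 1 x) has_real_derivative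
        - Polygamma 2 (1 - x) + Polygamma 2 x) (at x)"
      using nz by (auto intro!: derivative_eq_intros simp: numeral_2_eq_2)
    show "((\<lambda>x. pi\<^sup>2 / (sin (pi * x))\<^sup>2) has_real_derivative
        - (2 * pi ^ 3 * cos (pi * x) / sin (pi * x) ^ 3)) (at x)"
      using s by (auto intro!: derivative_eq_intros simp: field_simps power_numeral_reduce)
  qed (use x Polygamma_1_reflection_real in auto)
  then show ?thesis by simp
qed

text \<open>With \<open>x = a / k\<close> the summand is \<open>1 / (x + m) ^ 3\<close> divided by
  \<open>k ^ 3\<close>, and the defining series is
  \<open>Polygamma 2 x = - 2 * (\<Sum>m. 1 / (x + m) ^ 3)\<close>.\<close>

lemma cubic_residue_class_sums:
  fixes k a :: nat
  assumes k: "k > 0" and a: "a > 0"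
  shows "(\<lambda>m. 1 / real (m * k + a) ^ 3) sums (- Polygamma 2 (real a / real k) / (2 * real k ^ 3))"
proof -
  let ?x = "real a / real k"
  have "summable (\<lambda>m. inverse ((?x + real m) ^ 3))"
    by (rule Polygamma_converges') (use assms in auto)
  then have "(\<lambda>m. inverse ((?x + real m) ^ 3)) sums (\<Sum>m. inverse ((?x + real m) ^ 3))"
    by (rule summable_sums)
  also have "(\<Sum>m. inverse ((?x + real m) ^ 3)) = - Polygamma 2 ?x / 2"
    by (simp add: Polygamma_def eval_nat_numeral)
  finally have "(\<lambda>m. inverse ((?x + real m) ^ 3) / real k ^ 3) sums (- Polygamma 2 ?x / 2 / real k ^ 3)"
    by (rule sums_divide)
  moreover have "inverse ((?x + real m) ^ 3) / real k ^ 3 = 1 / real (m * k + a) ^ 3" for m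
  proof -
    have "real (m * k + a) = (?x + real m) * real k"
      using k by (simp add: field_simps)
    then show ?thesis
      by (simp add: power_mult_distrib inverse_eq_divide)
  qed
  ultimately show ?thesis by simp
qed

subsection \<open>Finite Fourier analysis of a cubic\<close>

lemma sum_root_of_unity_powers:
  fixes z :: complex
  assumes "z ^ n = 1" "z \<noteq> 1"
  shows "(\<Sum>j=1..n. z ^ j) = 0"
proof -
  have "(\<Sum>j=1..n. z ^ j) = z * (\<Sum>j<n. z ^ j)"
    by (simp add: sum_distrib_left sum.atLeast1_atMost_eq)
  also have "(\<Sum>j<n. z ^ j) = 0"
    using assms geometric_sum[of z n] by simp
  finally show ?thesis by simp
qed

context
  fixes z :: complex and n :: nat
  assumes z: "z ^ n = 1" "z \<noteq> 1"
begin

text \<open>Abel summation: multiplying by \<open>1 - z\<close> replaces the weight by its backward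
  difference, which has lower degree. The boundary term carries \<open>z ^ Suc n\<close>, which is
  \<open>z\<close> because \<open>z ^ n = 1\<close>.\<close>

private lemma telescope:
  assumes "m > 0"
  shows "(1 - z) * (\<Sum>j=1..n. of_nat j ^ m * z ^ j) =
    (\<Sum>j=1..n. (of_nat j ^ m - of_nat (j - 1) ^ m) * z ^ j) - of_nat n ^ m * z"
proof -
  have "(1 - z) * (\<Sum>j=1..N. of_nat j ^ m * z ^ j) =
    (\<Sum>j=1..N. (of_nat j ^ m - of_nat (j - 1) ^ m) * z ^ j) - of_nat N ^ m * z ^ Suc N" for N
    by (induction N) (use assms in \<open>simp_all add: algebra_simps\<close>)
  from this[of n] show ?thesis using z by simp
qed

text \<open>The cubic is \<open>2 * n ^ 3\<close> times the Bernoulli polynomial B_3(x) = x (2x - 1)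
  (x - 1) / 2 at \<open>x = j / n\<close>. Its transform follows from the moments
  \<open>Q 0\<close>, ..., \<open>Q 3\<close>, each reduced to the earlier ones by
  \<open>telescope\<close>.\<close>

lemma sum_cubic_root_of_unity:
  assumes n: "n > 0"
  shows "(\<Sum>j=1..n. of_nat j * (2 * of_nat j - of_nat n) * (of_nat j - of_nat n) * z ^ j) =
    - 6 * of_nat n * z * (1 + z) / (1 - z) ^ 3"
proof -
  define Q where "Q m = (\<Sum>j=1..n. of_nat j ^ m * z ^ j)" for m
  define N :: complex where "N = of_nat n"
  define u where "u = 1 - z"
  have u: "u \<noteq> 0" "z = 1 - u" using z by (auto simp: u_def)
  have Q0: "Q 0 = 0"
    using sum_root_of_unity_powers[OF z] by (simp add: Q_def)
  have 1: "u * Q 1 = Q 0 - N * z"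
    unfolding u_def Q_def using telescope[of 1] by (simp add: N_def of_nat_diff)
  have "u * Q 2 = (\<Sum>j=1..n. (of_nat j ^ 2 - of_nat (j - 1) ^ 2) * z ^ j) - N ^ 2 * z"
    unfolding u_def Q_def using telescope[of 2] by (simp add: N_def)
  also have "(\<Sum>j=1..n. (of_nat j ^ 2 - of_nat (j - 1) ^ 2) * z ^ j) =
      (\<Sum>j=1..n. 2 * (of_nat j ^ 1 * z ^ j) - of_nat j ^ 0 * z ^ j)"
    by (intro sum.cong) (auto simp: of_nat_diff power2_eq_square algebra_simps)
  also have "\<dots> = 2 * Q 1 - Q 0"
    unfolding Q_def by (simp only: sum_subtractf sum_distrib_left)
  finally have 2: "u * Q 2 = 2 * Q 1 - Q 0 - N ^ 2 * z" .
  have "u * Q 3 = (\<Sum>j=1..n. (of_nat j ^ 3 - of_nat (j - 1) ^ 3) * z ^ j) - N ^ 3 * z"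
    unfolding u_def Q_def using telescope[of 3] by (simp add: N_def)
  also have "(\<Sum>j=1..n. (of_nat j ^ 3 - of_nat (j - 1) ^ 3) * z ^ j) =
      (\<Sum>j=1..n. 3 * (of_nat j ^ 2 * z ^ j) - 3 * (of_nat j ^ 1 * z ^ j) + of_nat j ^ 0 * z ^ j)"
    by (intro sum.cong) (auto simp: of_nat_diff power2_eq_square power3_eq_cube algebra_simps)
  also have "\<dots> = 3 * Q 2 - 3 * Q 1 + Q 0"
    unfolding Q_def by (simp only: sum_subtractf sum_distrib_left sum.distrib)
  finally have 3: "u * Q 3 = 3 * Q 2 - 3 * Q 1 + Q 0 - N ^ 3 * z" .
  have "(\<Sum>j=1..n. of_nat j * (2 * of_nat j - of_nat n) * (of_nat j - of_nat n) * z ^ j) =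
      (\<Sum>j=1..n. 2 * (of_nat j ^ 3 * z ^ j) - 3 * N * (of_nat j ^ 2 * z ^ j) + N ^ 2 * (of_nat j ^ 1 * z ^ j))"
    by (intro sum.cong) (auto simp: N_def power2_eq_square power3_eq_cube algebra_simps)
  also have "\<dots> = 2 * Q 3 - 3 * N * Q 2 + N ^ 2 * Q 1"
    unfolding Q_def by (simp only: sum_subtractf sum_distrib_left sum.distrib)
  also have "2 * Q 3 - 3 * N * Q 2 + N ^ 2 * Q 1 = - 6 * N * z * (1 + z) / u ^ 3"
  proof -
    \<comment> \<open>Scaling \<open>Q m\<close> by \<open>u ^ m\<close> clears all denominators, so
      the claim becomes a polynomial identity in \<open>N\<close>, \<open>z\<close> and
      \<open>u\<close>.\<close>
    have q1: "Q 1 * u = - N * z"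
      using 1 Q0 by (simp add: mult.commute)
    have "Q 2 * u ^ 2 = (u * Q 2) * u" by (simp add: power2_eq_square)
    also have "\<dots> = 2 * (Q 1 * u) - N ^ 2 * z * u" unfolding 2 Q0 by (simp add: algebra_simps)
    finally have q2: "Q 2 * u ^ 2 = - 2 * N * z - N ^ 2 * z * u" unfolding q1 by simp
    have "Q 3 * u ^ 3 = (u * Q 3) * u ^ 2" by (simp add: power2_eq_square power3_eq_cube)
    also have "\<dots> = 3 * (Q 2 * u ^ 2) - 3 * (Q 1 * u) * u - N ^ 3 * z * u ^ 2"
      unfolding 3 Q0 by (simp add: algebra_simps power2_eq_square)
    finally have q3: "Q 3 * u ^ 3 =
        3 * (- 2 * N * z - N ^ 2 * z * u) + 3 * N * z * u - N ^ 3 * z * u ^ 2"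
      unfolding q1 q2 by simp
    have "(2 * Q 3 - 3 * N * Q 2 + N ^ 2 * Q 1) * u ^ 3 =
        2 * (Q 3 * u ^ 3) - 3 * N * (Q 2 * u ^ 2) * u + N ^ 2 * (Q 1 * u) * u ^ 2"
      by (simp add: algebra_simps power2_eq_square power3_eq_cube)
    \<comment> \<open>The coefficients of the cubic are such that all terms in \<open>N ^ 2\<close>
      and \<open>N ^ 3\<close> cancel.\<close>
    also have "\<dots> = - 6 * N * z * (2 - u)"
      unfolding q1 q2 q3 by (simp add: algebra_simps power2_eq_square power3_eq_cube)
    also have "2 - u = 1 + z" by (simp add: u_def)
    finally show ?thesis using u(1) by (simp add: field_simps)
  qed
  finally show ?thesis by (simp add: N_def u_def)
qed

end

text \<open>Expanding the squared modulus leaves, for each pair \<open>i\<close>, \<open>j\<close>,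
  the sum over \<open>a\<close> of the powers of the root of unity \<open>w (i - j)\<close>. Since
  \<open>i - j\<close> is smaller than \<open>n\<close> in absolute value, this root is 1 only for
  \<open>i = j\<close>; otherwise its powers sum to 0.\<close>

lemma parseval_finite:
  fixes c :: "nat \<Rightarrow> real" and n :: nat
  assumes n: "n > 0"
  shows "(\<Sum>a=1..n. (cmod (\<Sum>j=1..n. of_real (c j) * cis (2 * pi * real a / real n) ^ j))\<^sup>2) =
    real n * (\<Sum>j=1..n. (c j)\<^sup>2)"
proof -
  define w where "w m = cis (2 * pi * real_of_int m / real n)" for m :: int
  have ortho: "(\<Sum>a=1..n. w (int i - int j) ^ a) = (if i = j then of_nat n else 0)"
    if ij: "i \<in> {1..n}" "j \<in> {1..n}" for i j
  proof (cases "i = j")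
    case False
    let ?z = "w (int i - int j)"
    have "?z ^ n = cis (2 * pi * real_of_int (int i - int j))"
      unfolding w_def Complex.DeMoivre using n by simp
    also have "\<dots> = 1" by (rule cis_multiple_2pi) auto
    finally have 1: "?z ^ n = 1" .
    have "?z \<noteq> 1"
    proof
      assume "?z = 1"
      then have "cos (2 * pi * real_of_int (int i - int j) / real n) = 1"
        by (metis w_def cis.sel(1) one_complex.sel(1))
      then obtain t :: int where "2 * pi * real_of_int (int i - int j) / real n = real_of_int t * 2 * pi"
        by (auto simp: cos_one_2pi_int)
      then have "(2 * pi) * real_of_int (int i - int j) = (2 * pi) * real_of_int (t * int n)"
        using n by (simp add: field_simps)
      then have "real_of_int (int i - int j) = real_of_int (t * int n)"
        by (subst (asm) mult_left_cancel) auto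
      then have *: "int i - int j = t * int n" by (simp only: of_int_eq_iff)
      then have "int n dvd int i - int j" by simp
      moreover have "\<bar>int i - int j\<bar> < int n" using ij by auto
      ultimately show False using dvd_imp_le_int[of "int i - int j" "int n"] False by auto
    qed
    with 1 show ?thesis using sum_root_of_unity_powers[of ?z n] False by simp
  qed (simp add: w_def)
  have "complex_of_real (\<Sum>a=1..n. (cmod (\<Sum>j=1..n. of_real (c j) * cis (2 * pi * real a / real n) ^ j))\<^sup>2) =
    (\<Sum>a=1..n. \<Sum>i=1..n. \<Sum>j=1..n. of_real (c i * c j) * w (int i - int j) ^ a)"
  proof (subst of_real_sum, rule sum.cong[OF refl])
    fix a
    let ?S = "\<Sum>j=1..n. of_real (c j) * cis (2 * pi * real a / real n) ^ j"
    have "of_real ((cmod ?S)\<^sup>2) = ?S * cnj ?S" by (rule complex_norm_square)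
    also have "\<dots> = (\<Sum>i=1..n. \<Sum>j=1..n. (of_real (c i) * cis (2 * pi * real a / real n) ^ i) *
        cnj (of_real (c j) * cis (2 * pi * real a / real n) ^ j))"
      by (simp only: cnj_sum sum_product)
    also have "\<dots> = (\<Sum>i=1..n. \<Sum>j=1..n. of_real (c i * c j) * w (int i - int j) ^ a)"
      by (intro sum.cong refl)
        (auto simp: w_def cis_cnj Complex.DeMoivre cis_mult algebra_simps diff_divide_distrib)
    finally show "of_real ((cmod ?S)\<^sup>2) = \<dots>" .
  qed
  also have "\<dots> = (\<Sum>i=1..n. \<Sum>j=1..n. \<Sum>a=1..n. of_real (c i * c j) * w (int i - int j) ^ a)"
    by (rule trans[OF sum.swap], rule sum.cong[OF refl], rule sum.swap)
  also have "\<dots> = (\<Sum>i=1..n. \<Sum>j=1..n. if i = j then of_real (c i * c j) * of_nat n else 0)"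
  proof (intro sum.cong refl)
    fix i j assume "i \<in> {1..n}" "j \<in> {1..n}"
    then show "(\<Sum>a=1..n. of_real (c i * c j) * w (int i - int j) ^ a) =
        (if i = j then of_real (c i * c j) * of_nat n else 0)"
      by (subst sum_distrib_left[symmetric], subst ortho) auto
  qed
  also have "\<dots> = of_real (real n * (\<Sum>j=1..n. (c j)\<^sup>2))"
    by (simp add: sum_distrib_left power2_eq_square mult_ac)
  finally show ?thesis by (simp only: of_real_eq_iff)
qed

lemma sum_cubic_squares:
  fixes n :: nat
  shows "(\<Sum>j=1..n. (real j * (2 * real j - real n) * (real j - real n))\<^sup>2) =
     real n ^ 7 / 210 - real n ^ 3 / 10 + 2 * real n / 21"
proof -
  \<comment> \<open>For induction the upper limit \<open>N\<close> is separated from the parameter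
    \<open>x\<close>. The square expands to
    \<open>4 j^6 - 12 x j^5 + 13 x^2 j^4 - 6 x^3 j^3 + x^4 j^2\<close>, and the brackets are the
    power sum formulas for the exponents 6 down to 2.\<close>
  have powers: "(\<Sum>j=1..N. (real j * (2 * real j - x) * (real j - x))\<^sup>2) =
     4 * (real N ^ 7 / 7 + real N ^ 6 / 2 + real N ^ 5 / 2 - real N ^ 3 / 6 + real N / 42)
     - 12 * x * (real N ^ 6 / 6 + real N ^ 5 / 2 + 5 * real N ^ 4 / 12 - real N ^ 2 / 12)
     + 13 * x ^ 2 * (real N ^ 5 / 5 + real N ^ 4 / 2 + real N ^ 3 / 3 - real N / 30)
     - 6 * x ^ 3 * (real N ^ 4 / 4 + real N ^ 3 / 2 + real N ^ 2 / 4)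
     + x ^ 4 * (real N ^ 3 / 3 + real N ^ 2 / 2 + real N / 6)" for N x
  proof (induction N)
    case (Suc N)
    have "(\<Sum>j=1..Suc N. (real j * (2 * real j - x) * (real j - x))\<^sup>2) =
        (\<Sum>j=1..N. (real j * (2 * real j - x) * (real j - x))\<^sup>2) +
        ((real N + 1) * (2 * (real N + 1) - x) * ((real N + 1) - x))\<^sup>2"
      by (simp add: add_ac)
    then show ?case
      unfolding Suc of_nat_Suc by (simp add: field_simps power_numeral_reduce)
  qed simp
  show ?thesis
    unfolding powers by (simp add: field_simps power_numeral_reduce)
qed

text \<open>Pulling out \<open>cis t\<close> turns \<open>1 + cis (2 * t)\<close> into a cosine and
  \<open>1 - cis (2 * t)\<close> into a sine, up to factors of known modulus. The 4 is 2 ^ 3 /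
  2.\<close>

lemma cmod_cubic_kernel:
  "cmod (cis (2 * t) * (1 + cis (2 * t)) / (1 - cis (2 * t)) ^ 3) = \<bar>cos t / sin t ^ 3\<bar> / 4"
proof -
  have plus: "1 + cis (2 * t) = of_real (2 * cos t) * cis t"
    by (auto simp: complex_eq_iff cos_double_cos sin_double power2_eq_square)
  have minus: "1 - cis (2 * t) = - \<i> * of_real (2 * sin t) * cis t"
    by (auto simp: complex_eq_iff cos_double_sin sin_double power2_eq_square)
  show ?thesis
    unfolding plus minus
    by (simp add: norm_mult norm_divide norm_power abs_mult power_mult_distrib power_abs)
qed

lemma sum_cot_csc_squares:
  assumes n: "n > 0"
  shows "(\<Sum>a=1..n. (cos (pi * (real a / real n)) / sin (pi * (real a / real n)) ^ 3)\<^sup>2) =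
    2 * (real n ^ 6 - 1) / 945 - 2 * (real n ^ 2 - 1) / 45"
proof -
  define c where "c j = real j * (2 * real j - real n) * (real j - real n)" for j
  define w where "w a = cos (pi * (real a / real n)) / sin (pi * (real a / real n)) ^ 3" for a
  \<comment> \<open>The constant is \<open>(6 * n / 4)\<^sup>2\<close>, with \<open>6 * n\<close>
    from the transform of the cubic and the 4 from its kernel.\<close>
  have S: "(cmod (\<Sum>j=1..n. of_real (c j) * cis (2 * pi * real a / real n) ^ j))\<^sup>2 =
      9 / 4 * real n ^ 2 * (w a)\<^sup>2" if a: "a \<in> {1..n}" for a
  proof (cases "a = n")
    case True
    \<comment> \<open>At the frequency \<open>a = n\<close> the root of unity is 1 and the transform
      is the plain sum of the cubic, which is 0. This agrees with \<open>w n = 0\<close>, a division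
      by \<open>sin pi = 0\<close>.\<close>
    have "(\<Sum>j=1..N. real j * (2 * real j - x) * (real j - x)) =
        real N ^ 2 * (real N + 1) ^ 2 / 2 - x * (real N * (real N + 1) * (2 * real N + 1) / 2)
          + x\<^sup>2 * (real N * (real N + 1) / 2)" for N x
      by (induction N) (simp_all add: field_simps power2_eq_square)
    from this[where N = n and x = "real n"] have "(\<Sum>j=1..n. c j) = 0"
      unfolding c_def by (simp add: field_simps power2_eq_square)
    then have "(\<Sum>j=1..n. complex_of_real (c j)) = 0"
      by (simp flip: of_real_sum)
    then show ?thesis
      using n True by (simp add: w_def cis_2pi)
  next
    case False
    let ?t = "pi * (real a / real n)"
    have t: "0 < ?t" "?t < pi"
      using a False n by (auto simp: field_simps)
    have sin: "sin ?t > 0" by (rule sin_gt_zero[OF t])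
    have z: "cis (2 * pi * real a / real n) = cis (2 * ?t)" by (simp add: mult.assoc)
    have z1: "cis (2 * ?t) ^ n = 1"
      unfolding Complex.DeMoivre using n cis_multiple_2pi[of "real a"] by (simp add: mult_ac)
    have z2: "cis (2 * ?t) \<noteq> 1"
    proof
      assume "cis (2 * ?t) = 1"
      then have "cos (2 * ?t) = 1" by (metis cis.sel(1) one_complex.sel(1))
      then show False using sin cos_double_sin[of ?t] by simp
    qed
    have "(\<Sum>j=1..n. of_real (c j) * cis (2 * pi * real a / real n) ^ j) =
        - 6 * of_nat n * (cis (2 * ?t) * (1 + cis (2 * ?t)) / (1 - cis (2 * ?t)) ^ 3)"
      unfolding z c_def using sum_cubic_root_of_unity[OF z1 z2 n] by (simp add: mult_ac)
    then have "cmod (\<Sum>j=1..n. of_real (c j) * cis (2 * pi * real a / real n) ^ j) =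
        6 * real n * (\<bar>w a\<bar> / 4)"
      unfolding w_def cmod_cubic_kernel[symmetric] by (simp only: norm_mult) simp
    then show ?thesis
      by (simp only:) (simp add: power_mult_distrib power_divide)
  qed
  have "9 / 4 * real n ^ 2 * (\<Sum>a=1..n. (w a)\<^sup>2) =
      (\<Sum>a=1..n. (cmod (\<Sum>j=1..n. of_real (c j) * cis (2 * pi * real a / real n) ^ j))\<^sup>2)"
    unfolding sum_distrib_left by (intro sum.cong refl S[symmetric])
  also have "\<dots> = real n * (real n ^ 7 / 210 - real n ^ 3 / 10 + 2 * real n / 21)"
    unfolding parseval_finite[OF n] c_def sum_cubic_squares ..
  also have "\<dots> = 9 / 4 * real n ^ 2 * (2 * (real n ^ 6 - 1) / 945 - 2 * (real n ^ 2 - 1) / 45)"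
    by (simp add: field_simps power_numeral_reduce)
  finally show ?thesis
    unfolding w_def using n by (subst (asm) mult_left_cancel) auto
qed

subsection \<open>Jordan totients\<close>

text \<open>Reducing \<open>a / n\<close> to lowest terms gives the denominator
  \<open>n div gcd a n\<close>. The numerators are therefore sorted by their gcd with
  \<open>n\<close>, and the sum is finally reindexed by the complementary divisor.\<close>

lemma sum_fractions_eq_sum_totatives:
  fixes f :: "real \<Rightarrow> real"
  assumes n: "n > 0"
  shows "(\<Sum>a=1..n. f (real a / real n)) = (\<Sum>d | d dvd n. \<Sum>a\<in>totatives d. f (real a / real d))"
proof -
  define A where "A d = {a\<in>{0<..n}. gcd a n = d}" for d
  have "{1..n} = (\<Union>d\<in>{d. d dvd n}. A d)" by (auto simp: A_def)
  then have "(\<Sum>a=1..n. f (real a / real n)) = (\<Sum>d | d dvd n. \<Sum>a\<in>A d. f (real a / real n))"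
    using n by (simp only:) (intro sum.UNION_disjoint, auto simp: A_def)
  also have "\<dots> = (\<Sum>d | d dvd n. \<Sum>a\<in>totatives (n div d). f (real a / real (n div d)))"
  proof (rule sum.cong[OF refl])
    fix d assume "d \<in> {d. d dvd n}"
    then have d: "d dvd n" by simp
    have "(\<Sum>a\<in>A d. f (real a / real n)) = (\<Sum>a\<in>totatives (n div d). f (real (a * d) / real n))"
      unfolding A_def by (rule sum.reindex_bij_betw[OF bij_betw_totatives_gcd_eq[OF d n], symmetric])
    also have "\<dots> = (\<Sum>a\<in>totatives (n div d). f (real a / real (n div d)))"
      using d n by (intro sum.cong refl) (auto simp: real_of_nat_div field_simps elim!: dvdE)
    finally show "(\<Sum>a\<in>A d. f (real a / real n)) = \<dots>" .
  qed
  also have "\<dots> = (\<Sum>d | d dvd n. \<Sum>a\<in>totatives d. f (real a / real d))"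
    by (rule sum.reindex_bij_witness[of _ "(div) n" "(div) n"]) (use n in \<open>auto elim: dvdE\<close>)
  finally show ?thesis .
qed

text \<open>The Euler product gains one factor, \<open>1 - 1 / p ^ s\<close>. Writing the result as
  a difference of consecutive powers makes the divisor sum below telescope.\<close>

lemma jordan_totient_prime_power_mult:
  assumes p: "prime p" "\<not> p dvd d" and d: "d > 0"
  shows "jordan_totient s (p ^ Suc e * d) =
    (real p ^ (s * Suc e) - real p ^ (s * e)) * jordan_totient s d"
proof -
  have "prime_factors (p ^ Suc e * d) = insert p (prime_factors d)"
    using p(1) d prime_gt_0_nat[OF p(1)] prime_factors_power[of "Suc e" p]
    by (subst prime_factors_product) (auto simp: prime_prime_factors simp del: power_Suc)
  moreover have "p \<notin> prime_factors d" using p by auto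
  moreover have "real p ^ s \<noteq> 0" using prime_gt_0_nat[OF p(1)] by simp
  ultimately show ?thesis
    unfolding jordan_totient_def
    by (simp add: power_mult_distrib power_add power_mult mult.commute[of s] field_simps)
qed

text \<open>A divisor either contains \<open>p\<close> at most \<open>e\<close> times, or contains
  the full power \<open>p ^ Suc e\<close> together with a divisor of \<open>m\<close>.\<close>

lemma divisors_prime_power_Suc_mult:
  fixes p m :: nat
  assumes p: "prime p" "\<not> p dvd m"
  shows "{d. d dvd p ^ Suc e * m} = {d. d dvd p ^ e * m} \<union> (\<lambda>d. p ^ Suc e * d) ` {d. d dvd m}" (is ?A)
    and "{d. d dvd p ^ e * m} \<inter> (\<lambda>d. p ^ Suc e * d) ` {d. d dvd m} = {}" (is ?B)
proof -
  have "d \<in> {d. d dvd p ^ e * m} \<union> (\<lambda>d. p ^ Suc e * d) ` {d. d dvd m}" if "d dvd p ^ Suc e * m" for d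
  proof -
    obtain b c where bc: "d = b * c" "b dvd p ^ Suc e" "c dvd m"
      using division_decomp[of d "p ^ Suc e" m] \<open>d dvd p ^ Suc e * m\<close> by blast
    obtain i where i: "i \<le> Suc e" "b = p ^ i"
      using bc(2) divides_primepow_nat[OF p(1)] by blast
    show ?thesis
    proof (cases "i = Suc e")
      case False
      then have "b dvd p ^ e" using i by (simp add: le_imp_power_dvd)
      then show ?thesis using bc by (simp add: mult_dvd_mono)
    next
      case True
      then show ?thesis using bc i by blast
    qed
  qed
  moreover have "d dvd p ^ Suc e * m" if "d dvd p ^ e * m" for d
    using that by (simp add: mult.assoc)
  moreover have "p ^ Suc e * d dvd p ^ Suc e * m" if "d dvd m" for d
    using that by (rule mult_dvd_mono[OF dvd_refl])
  ultimately show ?A by blast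
  have False if "p ^ Suc e * t dvd p ^ e * m" for t
  proof -
    have "p ^ e * (p * t) dvd p ^ e * m" using that by (simp add: mult_ac)
    then have "p * t dvd m" using p by (simp add: nat_mult_dvd_cancel_disj prime_gt_0_nat)
    then show False using p(2) dvd_mult_left by blast
  qed
  then show ?B by blast
qed

text \<open>Strong induction removes the full power of one prime \<open>p\<close>, leaving a
  cofactor \<open>m\<close> prime to \<open>p\<close>. An inner induction restores \<open>p\<close>
  one factor at a time: the new divisors contribute
  \<open>(p ^ (s * Suc e) - p ^ (s * e)) * m ^ s\<close>, exactly the increment of the right-hand
  side.\<close>

lemma jordan_totient_divisor_sum:
  assumes "n > 0"
  shows "(\<Sum>d | d dvd n. jordan_totient s d) = real n ^ s"
  using assms
proof (induction n rule: less_induct)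
  case (less n)
  show ?case
  proof (cases "n = 1")
    case True
    then show ?thesis by (simp add: jordan_totient_def)
  next
    case False
    then obtain p where p: "prime p" "p dvd n" using prime_factor_nat by blast
    obtain m where m: "n = p ^ multiplicity p n * m" "\<not> p dvd m"
      using multiplicity_decompose'[of n p] less.prems p by (metis neq0_conv not_prime_unit)
    have m0: "m > 0" using m less.prems by (cases m) auto
    have "multiplicity p n > 0"
      using p less.prems by (simp add: prime_multiplicity_gt_zero_iff)
    then have "p ^ multiplicity p n > 1" using prime_gt_1_nat[OF p(1)] by (intro one_less_power)
    then have "m < n" using m0 m(1) by (metis mult.commute mult.right_neutral nat_mult_less_cancel1)
    then have IH: "(\<Sum>d | d dvd m. jordan_totient s d) = real m ^ s"
      using less.IH m0 by blast
    have "(\<Sum>d | d dvd p ^ e * m. jordan_totient s d) = real (p ^ e * m) ^ s" for e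
    proof (induction e)
      case (Suc e)
      have pe: "p ^ e > 0" "p ^ Suc e > 0" using prime_gt_0_nat[OF p(1)] by auto
      have "(\<Sum>d | d dvd p ^ Suc e * m. jordan_totient s d) =
          real (p ^ e * m) ^ s + (\<Sum>d\<in>(\<lambda>d. p ^ Suc e * d) ` {d. d dvd m}. jordan_totient s d)"
        unfolding divisors_prime_power_Suc_mult(1)[OF p(1) m(2)]
        using pe m0 divisors_prime_power_Suc_mult(2)[OF p(1) m(2)] Suc
        by (subst sum.union_disjoint) auto
      also have "(\<Sum>d\<in>(\<lambda>d. p ^ Suc e * d) ` {d. d dvd m}. jordan_totient s d) =
          (\<Sum>d | d dvd m. jordan_totient s (p ^ Suc e * d))"
        using pe(2) by (subst sum.reindex) (auto simp: inj_on_def simp del: power_Suc)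
      also have "\<dots> = (\<Sum>d | d dvd m. (real p ^ (s * Suc e) - real p ^ (s * e)) * jordan_totient s d)"
        using m m0 p(1)
        by (intro sum.cong refl jordan_totient_prime_power_mult) (auto intro: dvd_trans dvd_pos_nat)
      also have "\<dots> = (real p ^ (s * Suc e) - real p ^ (s * e)) * real m ^ s"
        by (simp only: IH flip: sum_distrib_left)
      finally show ?case
        by (simp add: algebra_simps power_mult_distrib power_add flip: power_mult)
    qed (use IH in simp)
    then show ?thesis using m(1) by metis
  qed
qed

text \<open>Strong induction takes the place of Moebius inversion. The divisor sums of the two sides
  differ by a constant, which is the discrepancy at the divisor 1: there the left side is 0 by
  division by zero, the right side is not.\<close>

lemma sum_totatives_cot_csc_squares:
  assumes "n > 1"
  shows "(\<Sum>a\<in>totatives n. (cos (pi * (real a / real n)) / sin (pi * (real a / real n)) ^ 3)\<^sup>2) =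
    2 / 45 * (jordan_totient 6 n / 21 - jordan_totient 2 n)"
proof -
  define F where
    "F n = (\<Sum>a\<in>totatives n. (cos (pi * (real a / real n)) / sin (pi * (real a / real n)) ^ 3)\<^sup>2)" for n
  define G where "G n = 2 / 45 * (jordan_totient 6 n / 21 - jordan_totient 2 n)" for n
  have F: "(\<Sum>d | d dvd n. F d) = 2 * (real n ^ 6 - 1) / 945 - 2 * (real n ^ 2 - 1) / 45" if "n > 0" for n
    unfolding F_def using sum_cot_csc_squares[OF that]
      sum_fractions_eq_sum_totatives[OF that, of "\<lambda>x. (cos (pi * x) / sin (pi * x) ^ 3)\<^sup>2"] by simp
  have G: "(\<Sum>d | d dvd n. G d) = 2 / 45 * (real n ^ 6 / 21 - real n ^ 2)" if "n > 0" for n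
    unfolding G_def using jordan_totient_divisor_sum[OF that]
    by (simp add: sum_subtractf flip: sum_distrib_left sum_divide_distrib)
  \<comment> \<open>The constant is \<open>2 / 45 - 2 / 945\<close>, and for \<open>n = 1\<close> it
    is the value of \<open>F 1 - G 1\<close>.\<close>
  have FG: "(\<Sum>d | d dvd n. F d - G d) = 8 / 189" if "n > 0" for n
    using F[OF that] G[OF that] by (simp add: sum_subtractf field_simps)
  have "F n - G n = 0" if "n > 1" for n
    using that
  proof (induction n rule: less_induct)
    case (less n)
    have "(\<Sum>d | d dvd n. F d - G d) = (\<Sum>d\<in>{1, n}. F d - G d)"
    proof (rule sum.mono_neutral_right)
      show "\<forall>d\<in>{d. d dvd n} - {1, n}. F d - G d = 0"
      proof
        fix d assume d: "d \<in> {d. d dvd n} - {1, n}"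
        then have "d < n" using less.prems by (auto dest: dvd_imp_le)
        moreover have "d \<noteq> 0" using d less.prems by auto
        ultimately show "F d - G d = 0" using d by (intro less.IH) auto
      qed
    qed (use less.prems in auto)
    then show ?case using FG[of n] FG[of 1] less.prems by simp
  qed
  then show ?thesis using assms by (simp add: F_def G_def)
qed

subsection \<open>Existence of Dirichlet characters\<close>

lemma euler_theorem_int:
  assumes "coprime a (int k)" "k > 0"
  shows "[a ^ totient k = 1] (mod int k)"
proof -
  define m where "m = nat (a mod int k)"
  have m: "int m = a mod int k" using assms by (simp add: m_def)
  have "coprime (int m) (int k)" using assms by (simp add: m)
  then have "[m ^ totient k = 1] (mod k)" by (intro euler_theorem) simp
  then have "[int m ^ totient k = 1] (mod int k)"
    by (metis cong_int_iff of_nat_1 of_nat_power)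
  moreover have "[a = int m] (mod int k)" by (simp add: m cong_def)
  ultimately show ?thesis by (meson cong_pow cong_trans)
qed

text \<open>Characters of a subgroup of the units modulo \<open>k\<close>, the subgroup being given as a union \<open>H\<close> of
  residue classes. Such a character extends to one more unit \<open>g\<close> by any choice of an \<open>e\<close>-th root of
  its value at \<open>g ^ e\<close>, where \<open>g ^ e\<close> is the first positive power of \<open>g\<close> in \<open>H\<close>.\<close>

definition partial_character :: "nat \<Rightarrow> int set \<Rightarrow> (int \<Rightarrow> complex) \<Rightarrow> bool" where
  "partial_character k H f \<longleftrightarrow>
     1 \<in> H \<and> f 1 = 1 \<and> (\<forall>a\<in>H. coprime a (int k)) \<and>
     (\<forall>a\<in>H. \<forall>b\<in>H. a * b \<in> H \<and> f (a * b) = f a * f b) \<and>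
     (\<forall>a\<in>H. \<forall>b. [a = b] (mod int k) \<longrightarrow> b \<in> H \<and> f b = f a)"

lemma partial_character_power:
  assumes "partial_character k H f" "a \<in> H"
  shows "a ^ j \<in> H \<and> f (a ^ j) = f a ^ j"
proof (induction j)
  case 0
  have "1 \<in> H \<and> f 1 = 1" using assms unfolding partial_character_def by blast
  then show ?case by simp
next
  case (Suc j)
  then have "a * a ^ j \<in> H \<and> f (a * a ^ j) = f a * f (a ^ j)"
    using assms unfolding partial_character_def by blast
  then show ?case using Suc by simp
qed

text \<open>Closure under inverses comes for free: by Euler's theorem
  \<open>a ^ (totient k - 1)\<close> is an inverse of \<open>a\<close> modulo \<open>k\<close>, and
  it is a power of an element of \<open>H\<close>.\<close>

lemma partial_character_cancel:
  assumes pc: "partial_character k H f" and k: "k > 0" and a: "a \<in> H" and ab: "a * b \<in> H"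
  shows "b \<in> H"
proof -
  have cop: "coprime a (int k)" using pc a by (simp add: partial_character_def)
  have "a ^ totient k = a * a ^ (totient k - 1)"
    using k by (simp flip: power_Suc)
  then have "[a ^ (totient k - 1) * (a * b) = 1 * b] (mod int k)"
    using cong_mult[OF euler_theorem_int[OF cop k] cong_refl[of b]] by (simp add: mult_ac)
  moreover have "a ^ (totient k - 1) * (a * b) \<in> H"
    using partial_character_power[OF pc a] ab pc by (simp add: partial_character_def)
  ultimately show ?thesis using pc unfolding partial_character_def by (metis mult_1)
qed

lemma partial_character_extend:
  assumes pc: "partial_character k H f" and k: "k > 0" and g: "coprime g (int k)"
    and e: "e > 0" "g ^ e \<in> H" and min: "\<And>j. 0 < j \<Longrightarrow> j < e \<Longrightarrow> g ^ j \<notin> H"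
    and z: "z ^ e = f (g ^ e)"
  shows "\<exists>H' f'. partial_character k H' f' \<and> H \<subseteq> H' \<and> g \<in> H' \<and> f' g = z \<and> (\<forall>a\<in>H. f' a = f a)"
proof -
  have one: "1 \<in> H" "f 1 = 1"
    and cop: "\<And>a. a \<in> H \<Longrightarrow> coprime a (int k)"
    and mult: "\<And>a b. a \<in> H \<Longrightarrow> b \<in> H \<Longrightarrow> a * b \<in> H"
      "\<And>a b. a \<in> H \<Longrightarrow> b \<in> H \<Longrightarrow> f (a * b) = f a * f b"
    and cng: "\<And>a b. a \<in> H \<Longrightarrow> [a = b] (mod int k) \<Longrightarrow> b \<in> H"
      "\<And>a b. a \<in> H \<Longrightarrow> [a = b] (mod int k) \<Longrightarrow> f b = f a"
    using pc unfolding partial_character_def by blast+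
  \<comment> \<open>By cancellation the remainder \<open>d mod e\<close> is also an exponent with
    \<open>g\<close> to that power in \<open>H\<close>; minimality of \<open>e\<close> makes it 0,
    so \<open>d\<close> is a multiple of \<open>e\<close> and the choice of \<open>z\<close>
    applies.\<close>
  have power_g: "f (g ^ d) = z ^ d" if "g ^ d \<in> H" for d
  proof -
    have d: "g ^ d = (g ^ e) ^ (d div e) * g ^ (d mod e)"
      by (simp flip: power_mult power_add)
    note pe = partial_character_power[OF pc e(2), of "d div e"]
    have "g ^ (d mod e) \<in> H"
      using partial_character_cancel[OF pc k, of "(g ^ e) ^ (d div e)"] pe that d by metis
    then have "d mod e = 0" using min e(1) by (meson mod_less_divisor neq0_conv)
    then have d': "d = e * (d div e)" by auto
    have "f (g ^ d) = f ((g ^ e) ^ (d div e))" by (metis d' power_mult)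
    also have "\<dots> = (z ^ e) ^ (d div e)" using pe z by simp
    also have "\<dots> = z ^ d" using d' by (metis power_mult)
    finally show ?thesis .
  qed
  \<comment> \<open>The prospective value at \<open>h * g ^ i\<close> does not depend on the
    representation: cancelling \<open>g ^ i\<close> shows \<open>g ^ (j - i)\<close> to be in
    \<open>H\<close>.\<close>
  have wd_le: "f h * z ^ i = f h' * z ^ j"
    if h: "h \<in> H" "h' \<in> H" "[h * g ^ i = h' * g ^ j] (mod int k)" "i \<le> j" for h h' i j
  proof -
    have "g ^ j = g ^ (j - i) * g ^ i" using h(4) by (simp flip: power_add)
    then have "[h * g ^ i = (h' * g ^ (j - i)) * g ^ i] (mod int k)"
      using h(3) by (simp add: mult_ac)
    then have c: "[h = h' * g ^ (j - i)] (mod int k)"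
      using g by (simp add: cong_mult_rcancel)
    then have "h' * g ^ (j - i) \<in> H" using cng h by blast
    then have gd: "g ^ (j - i) \<in> H" using partial_character_cancel[OF pc k h(2)] by blast
    have "f h = f h' * z ^ (j - i)"
      using cng(2)[OF h(1) c] mult(2)[OF h(2) gd] power_g[OF gd] by simp
    then show ?thesis using h(4) by (simp flip: power_add)
  qed
  have wd: "f h * z ^ i = f h' * z ^ j"
    if h: "h \<in> H" "h' \<in> H" "[h * g ^ i = h' * g ^ j] (mod int k)" for h h' i j
    using wd_le[OF h] wd_le[OF h(2,1) cong_sym[OF h(3)]] by (cases "i \<le> j") auto
  \<comment> \<open>The subgroup generated by \<open>H\<close> and \<open>g\<close>; nonnegative
    exponents suffice because \<open>g\<close> has finite order modulo \<open>k\<close>.\<close>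
  define H' where "H' = {n. \<exists>h\<in>H. \<exists>j. [n = h * g ^ j] (mod int k)}"
  define f' where "f' n = (SOME y. \<exists>h\<in>H. \<exists>j. [n = h * g ^ j] (mod int k) \<and> y = f h * z ^ j)" for n
  have f': "f' n = f h * z ^ j" if "h \<in> H" "[n = h * g ^ j] (mod int k)" for n h j
    unfolding f'_def using that by (intro some_equality) (auto intro: wd cong_trans cong_sym)
  have sub: "a \<in> H' \<and> f' a = f a" if "a \<in> H" for a
    using f'[of a a 0] that unfolding H'_def by (auto intro!: bexI[of _ a] exI[of _ 0])
  have "partial_character k H' f'"
    unfolding partial_character_def
  proof (intro conjI ballI allI impI)
    show "1 \<in> H'" "f' 1 = 1" using sub one by auto
  next
    fix a assume "a \<in> H'"
    then obtain h j where "h \<in> H" "[a = h * g ^ j] (mod int k)" by (auto simp: H'_def)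
    then show "coprime a (int k)"
      using g cop by (metis cong_imp_coprime cong_sym coprime_mult_left_iff coprime_power_left_iff)
  next
    fix a b assume "a \<in> H'" "b \<in> H'"
    then obtain h i h' j where *: "h \<in> H" "[a = h * g ^ i] (mod int k)"
      "h' \<in> H" "[b = h' * g ^ j] (mod int k)" by (auto simp: H'_def)
    have c: "[a * b = (h * h') * g ^ (i + j)] (mod int k)"
      using cong_mult[OF *(2,4)] by (simp add: power_add mult_ac)
    show "a * b \<in> H'" using c mult(1)[OF *(1,3)] by (auto simp: H'_def)
    show "f' (a * b) = f' a * f' b"
      using f'[OF mult(1)[OF *(1,3)] c] f'[OF *(1,2)] f'[OF *(3,4)] mult(2)[OF *(1,3)]
      by (simp add: power_add)
  next
    fix a b assume "a \<in> H'" and ab: "[a = b] (mod int k)"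
    then obtain h j where *: "h \<in> H" "[a = h * g ^ j] (mod int k)" by (auto simp: H'_def)
    have **: "[b = h * g ^ j] (mod int k)" using * ab by (meson cong_sym cong_trans)
    show "b \<in> H'" using * ** by (auto simp: H'_def)
    show "f' b = f' a" using f'[OF *] f'[OF *(1) **] by simp
  qed
  moreover have "g \<in> H'" using one by (auto simp: H'_def intro!: bexI[of _ 1] exI[of _ 1])
  moreover have "f' g = z" using f'[of 1 g 1] one by simp
  ultimately show ?thesis using sub by blast
qed

lemma exists_complex_nth_root:
  fixes c :: complex
  assumes "n > 0"
  shows "\<exists>z. z ^ n = c"
proof (cases "c = 0")
  case False
  then have "exp (Ln c / of_nat n) ^ n = c"
    using assms by (simp flip: exp_of_nat_mult)
  then show ?thesis by blast
qed (use assms in auto)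

lemma partial_character_least_power:
  assumes pc: "partial_character k H f" and k: "k > 0" and g: "coprime g (int k)"
  obtains e where "e > 0" "g ^ e \<in> H" "\<And>j. 0 < j \<Longrightarrow> j < e \<Longrightarrow> g ^ j \<notin> H"
proof -
  let ?P = "\<lambda>e. e > 0 \<and> g ^ e \<in> H"
  have "1 \<in> H" using pc by (simp add: partial_character_def)
  then have "g ^ totient k \<in> H"
    using pc cong_sym[OF euler_theorem_int[OF g k]] unfolding partial_character_def by blast
  then have "?P (totient k)" using k by simp
  then have "?P (LEAST e. ?P e)" by (rule LeastI)
  then show ?thesis using not_less_Least[of _ ?P] that[of "LEAST e. ?P e"] by blast
qed

text \<open>There are finitely many unit residues modulo \<open>k\<close>, so adjoining their
  representatives one at a time reaches a character on all units, which is then set to 0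
  elsewhere.\<close>

lemma partial_character_extend_total:
  assumes pc: "partial_character k H f" and k: "k > 0"
  obtains \<psi> where "dirichlet_character k \<psi>" "\<And>a. a \<in> H \<Longrightarrow> \<psi> a = f a"
proof -
  have "\<exists>H' f'. partial_character k H' f' \<and> H \<subseteq> H' \<and> A \<subseteq> H' \<and> (\<forall>a\<in>H. f' a = f a)"
    if "finite A" "\<forall>a\<in>A. coprime a (int k)" for A
    using that
  proof (induction A rule: finite_induct)
    case empty
    then show ?case using pc by blast
  next
    case (insert g A)
    then obtain H1 f1 where 1: "partial_character k H1 f1" "H \<subseteq> H1" "A \<subseteq> H1" "\<forall>a\<in>H. f1 a = f a"
      by auto
    have g: "coprime g (int k)" using insert by simp
    obtain e where e: "e > 0" "g ^ e \<in> H1" "\<And>j. 0 < j \<Longrightarrow> j < e \<Longrightarrow> g ^ j \<notin> H1"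
      using partial_character_least_power[OF 1(1) k g] by blast
    obtain z where z: "z ^ e = f1 (g ^ e)" using exists_complex_nth_root[OF e(1)] by blast
    obtain H2 f2 where "partial_character k H2 f2" "H1 \<subseteq> H2" "g \<in> H2" "\<forall>a\<in>H1. f2 a = f1 a"
      using partial_character_extend[OF 1(1) k g e z] by blast
    moreover from this have "H \<subseteq> H2" "insert g A \<subseteq> H2" "\<forall>a\<in>H. f2 a = f a" using 1 by auto
    ultimately show ?case by blast
  qed
  from this[of "{a\<in>{0..<int k}. coprime a (int k)}"]
  obtain H' f' where H': "partial_character k H' f'" "{a\<in>{0..<int k}. coprime a (int k)} \<subseteq> H'"
    "\<forall>a\<in>H. f' a = f a" by fastforce
  have all: "a \<in> H'" if "coprime a (int k)" for a
  proof -
    have "a mod int k \<in> {a\<in>{0..<int k}. coprime a (int k)}" using that k by simp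
    then have "a mod int k \<in> H'" using H'(2) by blast
    moreover have "[a mod int k = a] (mod int k)" by simp
    ultimately show ?thesis using H'(1) unfolding partial_character_def by blast
  qed
  have nz: "f' a \<noteq> 0" if "coprime a (int k)" for a
  proof -
    have "f' a ^ totient k = f' (a ^ totient k)"
      using partial_character_power[OF H'(1) all[OF that]] by simp
    also have "\<dots> = f' 1"
      using H'(1) all[of 1] cong_sym[OF euler_theorem_int[OF that k]]
      unfolding partial_character_def by auto
    also have "\<dots> = 1" using H'(1) by (simp add: partial_character_def)
    finally show ?thesis using k by (auto simp: power_0_left)
  qed
  define \<psi> where "\<psi> a = (if coprime a (int k) then f' a else 0)" for a
  have "dirichlet_character k \<psi>"
    unfolding dirichlet_character_def
  proof (intro conjI allI)
    fix n
    have "[n = n + int k] (mod int k)" by (simp add: cong_def)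
    then have "coprime n (int k) \<Longrightarrow> f' (n + int k) = f' n"
      using H'(1) all unfolding partial_character_def by blast
    moreover have "coprime (n + int k) (int k) \<longleftrightarrow> coprime n (int k)"
      by (simp add: coprime_iff_gcd_eq_1)
    ultimately show "\<psi> (n + int k) = \<psi> n"
      by (simp add: \<psi>_def)
    show "\<psi> n \<noteq> 0 \<longleftrightarrow> coprime n (int k)" using nz by (simp add: \<psi>_def)
  next
    fix m n
    have "f' (m * n) = f' m * f' n" if "coprime m (int k)" "coprime n (int k)"
      using H'(1) all[OF that(1)] all[OF that(2)] unfolding partial_character_def by blast
    then show "\<psi> (m * n) = \<psi> m * \<psi> n"
      by (simp add: \<psi>_def)
  qed
  moreover have "\<psi> a = f a" if "a \<in> H" for a
  proof -
    have "coprime a (int k)" using that pc unfolding partial_character_def by blast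
    then show ?thesis using that H'(3) by (simp add: \<psi>_def)
  qed
  ultimately show ?thesis using that by blast
qed

subsection \<open>Orthogonality of the odd characters\<close>

lemma dirichlet_character_cong:
  assumes "dirichlet_character k \<psi>" "[a = b] (mod int k)"
  shows "\<psi> a = \<psi> b"
  using assms dirichlet_character_mod unfolding cong_def by metis

lemma dirichlet_character_mult: "dirichlet_character k \<psi> \<Longrightarrow> \<psi> (a * b) = \<psi> a * \<psi> b"
  by (simp add: dirichlet_character_def)

lemma dirichlet_character_eq_0_iff: "dirichlet_character k \<psi> \<Longrightarrow> \<psi> a = 0 \<longleftrightarrow> \<not> coprime a (int k)"
  by (auto simp: dirichlet_character_def)

lemma dirichlet_character_1: "dirichlet_character k \<psi> \<Longrightarrow> \<psi> 1 = 1"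
  using dirichlet_character_mult[of k \<psi> 1 1] dirichlet_character_eq_0_iff[of k \<psi> 1] by auto

lemma dirichlet_character_power: "dirichlet_character k \<psi> \<Longrightarrow> \<psi> (a ^ j) = \<psi> a ^ j"
  by (induction j) (simp_all add: dirichlet_character_1 dirichlet_character_mult)

lemma dirichlet_character_norm:
  assumes "dirichlet_character k \<psi>" "k > 0" "coprime a (int k)"
  shows "norm (\<psi> a) = 1"
  using power_eq_1_iff[OF dirichlet_character_root_of_unity[OF assms(1,3,2)]] assms(2) by simp

lemma dirichlet_character_norm_le_1:
  assumes "dirichlet_character k \<psi>" "k > 0"
  shows "norm (\<psi> a) \<le> 1"
  using dirichlet_character_norm[OF assms, of a] dirichlet_character_eq_0_iff[OF assms(1), of a]
  by (cases "coprime a (int k)") auto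

text \<open>On the unit circle the conjugate is the inverse, and \<open>a ^ (totient k - 1)\<close>
  inverts \<open>a\<close> modulo \<open>k\<close>.\<close>

lemma dirichlet_character_cnj:
  assumes "dirichlet_character k \<psi>" "k > 0" and cop: "coprime a (int k)"
  shows "cnj (\<psi> a) = \<psi> (a ^ (totient k - 1))"
proof -
  have "\<psi> a * \<psi> a ^ (totient k - 1) = \<psi> a ^ totient k"
    using assms(2) by (simp flip: power_Suc)
  also have "\<dots> = 1" by (rule dirichlet_character_root_of_unity[OF assms(1) cop assms(2)])
  also have "1 = \<psi> a * cnj (\<psi> a)"
    using dirichlet_character_norm[OF assms] by (metis complex_norm_square of_real_1 one_power2)
  finally have "\<psi> a ^ (totient k - 1) = cnj (\<psi> a)"
    using dirichlet_character_eq_0_iff[OF assms(1), of a] cop by (subst (asm) mult_left_cancel) auto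
  then show ?thesis using dirichlet_character_power[OF assms(1)] by simp
qed

lemma dirichlet_character_times:
  assumes "dirichlet_character k \<psi>" "dirichlet_character k \<rho>"
  shows "dirichlet_character k (\<lambda>a. \<psi> a * \<rho> a)"
  using assms by (simp add: dirichlet_character_def)

lemma dirichlet_character_cnj_character:
  assumes "dirichlet_character k \<psi>"
  shows "dirichlet_character k (\<lambda>a. cnj (\<psi> a))"
  using assms by (simp add: dirichlet_character_def)

section \<open>Characters with prescribed value at -1, and sums over odd characters\<close>

lemma not_cong_minus_1_1_int:
  assumes "k \<ge> 3"
  shows "\<not> [- 1 = 1] (mod int k)"
proof
  assume "[- 1 = 1] (mod int k)"
  then have "int k dvd - 2" by (simp add: cong_iff_dvd_diff)
  then have "int k \<le> 2" using zdvd_imp_le[of "int k" 2] by simp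
  then show False using assms by simp
qed

text \<open>For \<open>k \<ge> 3\<close> the class of -1 has order 2, so the trivial character on
  the class of 1 extends to it with the square root -1 of 1 as value.\<close>

lemma odd_dirichlet_characters_nonempty:
  assumes k: "k \<ge> 3"
  shows "odd_dirichlet_characters k \<noteq> {}"
proof -
  let ?H = "{a. [1 = a] (mod int k)}"
  have pc: "partial_character k ?H (\<lambda>_. 1)"
    unfolding partial_character_def
    by (auto intro: cong_trans cong_imp_coprime dest: cong_mult)
  have "- 1 \<notin> ?H" using not_cong_minus_1_1_int[OF k] by (auto dest: cong_sym)
  then have "\<And>j. 0 < j \<Longrightarrow> j < 2 \<Longrightarrow> (- 1) ^ j \<notin> ?H"
    by (auto simp: less_2_cases_iff)
  then obtain H f where H: "partial_character k H f" "- 1 \<in> H" "f (- 1) = - 1"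
    using partial_character_extend[OF pc, of "- 1" 2 "- 1"] k by auto
  obtain \<psi> where "dirichlet_character k \<psi>" "\<And>a. a \<in> H \<Longrightarrow> \<psi> a = f a"
    using partial_character_extend_total[OF H(1)] k by auto
  then show ?thesis using H by (auto simp: odd_dirichlet_characters_def)
qed

text \<open>The trivial character on the classes of 1 and -1 is extended to \<open>n\<close>. As
  \<open>n\<close> lies outside these classes, its least power inside them has exponent
  \<open>e \<ge> 2\<close>, which leaves room for a value other than 1.\<close>

lemma even_dirichlet_character_separates:
  assumes k: "k > 0" and n: "coprime n (int k)" "\<not> [n = 1] (mod int k)" "\<not> [n = - 1] (mod int k)"
  obtains \<psi> where "dirichlet_character k \<psi>" "\<psi> (- 1) = 1" "\<psi> n \<noteq> 1"
proof -
  let ?H = "{a. [1 = a] (mod int k) \<or> [- 1 = a] (mod int k)}"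
  have pc: "partial_character k ?H (\<lambda>_. 1)"
    unfolding partial_character_def
  proof (intro conjI ballI allI impI)
    fix a assume "a \<in> ?H"
    then show "coprime a (int k)"
      by (auto dest: cong_imp_coprime)
  next
    fix a b assume "a \<in> ?H" "b \<in> ?H"
    then show "a * b \<in> ?H"
      using cong_mult[of 1 a "int k" 1 b] cong_mult[of 1 a "int k" "- 1" b]
        cong_mult[of "- 1" a "int k" 1 b] cong_mult[of "- 1" a "int k" "- 1" b]
      unfolding mem_Collect_eq mult_1_left mult_1_right minus_mult_minus by blast
  next
    fix a b assume "a \<in> ?H" "[a = b] (mod int k)"
    then show "b \<in> ?H" unfolding mem_Collect_eq by (meson cong_trans)
  qed auto
  obtain e where e: "e > 0" "n ^ e \<in> ?H" "\<And>j. 0 < j \<Longrightarrow> j < e \<Longrightarrow> n ^ j \<notin> ?H"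
    using partial_character_least_power[OF pc k n(1)] by metis
  have "n \<notin> ?H" using n by (auto dest: cong_sym)
  then have "e \<noteq> 1" using e(2) by (metis power_one_right)
  then have e2: "e \<ge> 2" using e(1) by simp
  \<comment> \<open>A primitive \<open>e\<close>-th root of unity, hence different from 1.\<close>
  define z where "z = cis (2 * pi / real e)"
  have z1: "z ^ e = 1" using e(1) by (simp add: z_def Complex.DeMoivre)
  have "z \<noteq> 1"
  proof
    assume "z = 1"
    then have "cos (2 * pi / real e) = 1" by (metis z_def cis.sel(1) one_complex.sel(1))
    then obtain t :: int where "2 * pi / real e = real_of_int t * 2 * pi" by (auto simp: cos_one_2pi_int)
    then have "(2 * pi) * 1 = (2 * pi) * real_of_int (t * int e)" using e(1) by (simp add: field_simps)
    then have "1 = real_of_int (t * int e)" by (subst (asm) mult_left_cancel) auto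
    then have "t * int e = 1" by linarith
    then show False using e2 zmult_eq_1_iff by auto
  qed
  have "\<exists>H f. partial_character k H f \<and> ?H \<subseteq> H \<and> n \<in> H \<and> f n = z \<and> (\<forall>a\<in>?H. f a = 1)"
    by (rule partial_character_extend[OF pc k n(1) e z1])
  then obtain H f where H: "partial_character k H f" "?H \<subseteq> H" "n \<in> H" "f n = z" "\<forall>a\<in>?H. f a = 1"
    by blast
  obtain \<psi> where \<psi>: "dirichlet_character k \<psi>" "\<And>a. a \<in> H \<Longrightarrow> \<psi> a = f a"
    using partial_character_extend_total[OF H(1) k] by blast
  have "- 1 \<in> ?H" by simp
  then have "- 1 \<in> H" "f (- 1) = 1" using H(2,5) by blast+
  then have "\<psi> (- 1) = 1" using \<psi>(2) by simp
  moreover have "\<psi> n \<noteq> 1" using \<psi>(2)[OF H(3)] H(4) \<open>z \<noteq> 1\<close> by simp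
  ultimately show ?thesis using that \<psi>(1) by blast
qed

text \<open>Multiplication by an even character \<open>\<rho>\<close> permutes the odd characters,
  so the sum equals \<open>\<rho> n\<close> times itself, and \<open>\<rho>\<close> can be chosen
  with \<open>\<rho> n \<noteq> 1\<close>.\<close>

lemma sum_odd_dirichlet_characters_eq_0:
  assumes k: "k > 0" and n: "coprime n (int k)" "\<not> [n = 1] (mod int k)" "\<not> [n = - 1] (mod int k)"
  shows "(\<Sum>\<psi>\<in>odd_dirichlet_characters k. \<psi> n) = 0"
proof -
  let ?O = "odd_dirichlet_characters k"
  obtain \<rho> where \<rho>: "dirichlet_character k \<rho>" "\<rho> (- 1) = 1" "\<rho> n \<noteq> 1"
    using even_dirichlet_character_separates[OF assms] by metis
  let ?m = "\<lambda>\<psi> a. \<rho> a * \<psi> a"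
  have inj: "inj_on ?m ?O"
  proof (rule inj_onI, rule ext)
    fix \<psi> \<psi>' a assume *: "\<psi> \<in> ?O" "\<psi>' \<in> ?O" "?m \<psi> = ?m \<psi>'"
    then have dc: "dirichlet_character k \<psi>" "dirichlet_character k \<psi>'"
      by (auto simp: odd_dirichlet_characters_def)
    show "\<psi> a = \<psi>' a"
      using fun_cong[OF *(3), of a] dirichlet_character_eq_0_iff[OF \<rho>(1), of a]
        dirichlet_character_eq_0_iff[OF dc(1), of a] dirichlet_character_eq_0_iff[OF dc(2), of a]
      by (cases "coprime a (int k)") auto
  qed
  have sub: "?m ` ?O \<subseteq> ?O"
    using \<rho> by (auto simp: odd_dirichlet_characters_def dirichlet_character_times)
  have im: "?m ` ?O = ?O"
    using endo_inj_surj[OF finite_odd_dirichlet_characters[OF k] sub inj] .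
  have "(\<Sum>\<psi>\<in>?O. \<psi> n) = (\<Sum>\<psi>\<in>?m ` ?O. \<psi> n)" by (simp only: im)
  also have "\<dots> = \<rho> n * (\<Sum>\<psi>\<in>?O. \<psi> n)"
    by (subst sum.reindex[OF inj]) (simp add: sum_distrib_left)
  finally have "(1 - \<rho> n) * (\<Sum>\<psi>\<in>?O. \<psi> n) = 0" by (simp add: algebra_simps)
  then show ?thesis using \<rho>(3) by simp
qed

text \<open>The dual argument: multiplication by \<open>b\<close> permutes the unit residues, so the
  sum equals \<open>\<psi> b\<close> times itself.\<close>

lemma dirichlet_character_sum_totatives_eq_0:
  assumes k: "k > 1" and \<psi>: "dirichlet_character k \<psi>" and b: "coprime b (int k)" "\<psi> b \<noteq> 1"
  shows "(\<Sum>a\<in>totatives k. \<psi> (int a)) = 0"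
proof -
  define c where "c = nat (b mod int k)"
  have c: "int c = b mod int k" using k by (simp add: c_def)
  have \<psi>c: "\<psi> (int c) = \<psi> b" using dirichlet_character_mod[OF \<psi>] by (simp add: c)
  have "coprime (int c) (int k)" using b k by (simp add: c)
  then have cc: "coprime c k" by simp
  let ?m = "\<lambda>a. (c * a) mod k"
  have inj: "inj_on ?m (totatives k)"
  proof (rule inj_onI)
    fix x y assume *: "x \<in> totatives k" "y \<in> totatives k" "?m x = ?m y"
    then have "[c * x = c * y] (mod k)" by (simp add: cong_def)
    then have "[x = y] (mod k)" using cc by (simp add: cong_mult_lcancel_nat coprime_commute)
    moreover have "x < k" "y < k" using * k by (auto intro: totatives_less)
    ultimately show "x = y" by (simp add: cong_def)
  qed
  have sub: "?m ` totatives k \<subseteq> totatives k"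
  proof (rule image_subsetI)
    fix x assume "x \<in> totatives k"
    then have "coprime (?m x) k" using cc k by (auto simp: in_totatives_iff)
    moreover have "?m x \<noteq> 0"
    proof
      assume "?m x = 0"
      then have "coprime 0 k" using calculation by metis
      then show False using k by simp
    qed
    ultimately show "?m x \<in> totatives k" using k by (auto simp: in_totatives_iff less_imp_le)
  qed
  have im: "?m ` totatives k = totatives k"
    by (rule endo_inj_surj[OF finite_totatives sub inj])
  have m: "\<psi> (int (?m a)) = \<psi> b * \<psi> (int a)" for a
    using dirichlet_character_mod[OF \<psi>, of "int c * int a"] dirichlet_character_mult[OF \<psi>] \<psi>c
    by (simp add: zmod_int)
  have "(\<Sum>a\<in>totatives k. \<psi> (int a)) = (\<Sum>a\<in>?m ` totatives k. \<psi> (int a))" by (simp only: im)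
  also have "\<dots> = \<psi> b * (\<Sum>a\<in>totatives k. \<psi> (int a))"
    by (subst sum.reindex[OF inj]) (simp only: o_def m sum_distrib_left)
  finally have "(1 - \<psi> b) * (\<Sum>a\<in>totatives k. \<psi> (int a)) = 0" by (simp add: algebra_simps)
  then show ?thesis using b by simp
qed

lemma dirichlet_character_orthogonal:
  assumes k: "k > 1" and "dirichlet_character k \<psi>" "dirichlet_character k \<rho>"
  shows "(\<Sum>a\<in>totatives k. \<psi> (int a) * cnj (\<rho> (int a))) = (if \<psi> = \<rho> then of_nat (totient k) else 0)"
proof (cases "\<psi> = \<rho>")
  case True
  have "\<psi> (int a) * cnj (\<psi> (int a)) = 1" if "a \<in> totatives k" for a
  proof -
    have "norm (\<psi> (int a)) = 1"
      using dirichlet_character_norm[OF assms(2)] k that by (simp add: in_totatives_iff)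
    then show ?thesis by (metis complex_norm_square of_real_1 one_power2)
  qed
  then show ?thesis using True by (simp add: totient_def)
next
  case False
  then obtain b where b: "\<psi> b \<noteq> \<rho> b" by blast
  then have cop: "coprime b (int k)"
    using assms dirichlet_character_eq_0_iff by metis
  have "\<rho> b * cnj (\<rho> b) = 1"
    using dirichlet_character_norm[OF assms(3) _ cop] k
    by (metis complex_norm_square of_real_1 one_power2 less_trans zero_less_one)
  then have "\<psi> b * cnj (\<rho> b) \<noteq> 1"
    using b by (metis mult_cancel_right mult_zero_right zero_neq_one)
  then show ?thesis
    using dirichlet_character_sum_totatives_eq_0[OF k dirichlet_character_times[OF assms(2)
        dirichlet_character_cnj_character[OF assms(3)]] cop] False by simp
qed

lemma odd_dirichlet_character_reflect:
  assumes "\<psi> \<in> odd_dirichlet_characters k" "a \<le> k"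
  shows "\<psi> (int (k - a)) = - \<psi> (int a)"
proof -
  have \<psi>: "dirichlet_character k \<psi>" "\<psi> (- 1) = - 1"
    using assms(1) by (auto simp: odd_dirichlet_characters_def)
  have "[int (k - a) = - 1 * int a] (mod int k)"
    using assms(2) by (simp add: cong_iff_dvd_diff of_nat_diff)
  then have "\<psi> (int (k - a)) = \<psi> (- 1 * int a)" by (rule dirichlet_character_cong[OF \<psi>(1)])
  also have "\<dots> = - \<psi> (int a)" unfolding dirichlet_character_mult[OF \<psi>(1)] \<psi>(2) by simp
  finally show ?thesis .
qed

text \<open>A fixed point of the reflection would give \<open>k = 2 * a\<close> with
  \<open>a\<close> prime to \<open>k\<close>, hence \<open>a = 1\<close> and
  \<open>k = 2\<close>.\<close>

lemma totatives_reflect: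
  assumes "k \<ge> 3" "a \<in> totatives k"
  shows "k - a \<in> totatives k" "a < k" "k - a \<noteq> a"
proof -
  show "a < k" using assms totatives_less[of a k] by simp
  have "coprime (k - a) k"
  proof (rule coprimeI)
    fix d assume d: "d dvd k - a" "d dvd k"
    have "d dvd k - (k - a)" by (intro dvd_diff_nat d)
    then have "d dvd a" using \<open>a < k\<close> by simp
    moreover have "coprime a k" using assms(2) by (simp add: in_totatives_iff)
    ultimately show "is_unit d" using d(2) by (meson coprime_common_divisor)
  qed
  then show "k - a \<in> totatives k" using \<open>a < k\<close> by (simp add: in_totatives_iff)
  show "k - a \<noteq> a"
  proof
    assume "k - a = a"
    then have "k = a * 2" using \<open>a < k\<close> by simp
    then have "a dvd k" by simp
    then have "a = 1" using assms(2) by (auto simp: in_totatives_iff coprime_absorb_left)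
    then show False using \<open>k = a * 2\<close> assms(1) by simp
  qed
qed

lemma sum_odd_dirichlet_characters_mult_cnj:
  assumes k: "k \<ge> 3" and a: "a \<in> totatives k" and b: "b \<in> totatives k"
  shows "(\<Sum>\<psi>\<in>odd_dirichlet_characters k. \<psi> (int a) * cnj (\<psi> (int b))) =
    of_nat (card (odd_dirichlet_characters k)) * ((if a = b then 1 else 0) - (if a = k - b then 1 else 0))"
proof -
  let ?O = "odd_dirichlet_characters k"
  have k0: "k > 0" using k by simp
  have cop: "coprime (int a) (int k)" "coprime (int b) (int k)"
    using a b by (auto simp: in_totatives_iff)
  have dc: "dirichlet_character k \<psi>" if "\<psi> \<in> ?O" for \<psi>
    using that by (simp add: odd_dirichlet_characters_def)
  have unit: "\<psi> (int b) * cnj (\<psi> (int b)) = 1" if "\<psi> \<in> ?O" for \<psi>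
    using dirichlet_character_norm[OF dc[OF that] k0 cop(2)]
    by (metis complex_norm_square of_real_1 one_power2)
  consider "a = b" | "a = k - b" | "a \<noteq> b" "a \<noteq> k - b" by blast
  then show ?thesis
  proof cases
    case 1
    then show ?thesis using unit totatives_reflect(3)[OF k b] by auto
  next
    case 2
    have "(\<Sum>\<psi>\<in>?O. \<psi> (int a) * cnj (\<psi> (int b))) = (\<Sum>\<psi>\<in>?O. - 1)"
    proof (rule sum.cong[OF refl])
      fix \<psi> assume \<psi>: "\<psi> \<in> ?O"
      have "\<psi> (int a) = - \<psi> (int b)"
        unfolding 2 using totatives_reflect(2)[OF k b] by (intro odd_dirichlet_character_reflect[OF \<psi>]) simp
      then show "\<psi> (int a) * cnj (\<psi> (int b)) = - 1" using unit[OF \<psi>] by simp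
    qed
    then show ?thesis using 2 totatives_reflect(3)[OF k b] by simp
  next
    case 3
    \<comment> \<open>The quotient of \<open>a\<close> by \<open>b\<close> modulo \<open>k\<close>;
      it is 1 or -1 only if \<open>a = b\<close> or \<open>a = k - b\<close>.\<close>
    define n where "n = int a * int b ^ (totient k - 1)"
    have nb: "[n * int b = int a] (mod int k)"
    proof -
      have "n * int b = int a * int b ^ totient k"
        using k0 by (simp add: n_def mult.assoc flip: power_Suc2)
      then show ?thesis using cong_mult[OF cong_refl[of "int a"] euler_theorem_int[OF cop(2) k0]] by simp
    qed
    have eq: "x = y" if "[int x = int y] (mod int k)" "x < k" "y < k" for x y
      using that by (simp add: cong_def)
    have "(\<Sum>\<psi>\<in>?O. \<psi> (int a) * cnj (\<psi> (int b))) = (\<Sum>\<psi>\<in>?O. \<psi> n)"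
    proof (rule sum.cong[OF refl])
      fix \<psi> assume \<psi>: "\<psi> \<in> ?O"
      show "\<psi> (int a) * cnj (\<psi> (int b)) = \<psi> n"
        using dirichlet_character_cnj[OF dc[OF \<psi>] k0 cop(2)]
        by (simp add: n_def dirichlet_character_mult[OF dc[OF \<psi>]])
    qed
    also have "\<dots> = 0"
    proof (rule sum_odd_dirichlet_characters_eq_0[OF k0])
      show "coprime n (int k)" using cop by (simp add: n_def)
      show "\<not> [n = 1] (mod int k)"
      proof
        assume "[n = 1] (mod int k)"
        from cong_mult[OF this cong_refl[of "int b"]] have "[int a = int b] (mod int k)"
          using nb by (metis cong_sym cong_trans mult_1)
        then show False using eq[of a b] 3 totatives_reflect(2)[OF k] a b by simp
      qed
      show "\<not> [n = - 1] (mod int k)"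
      proof
        assume "[n = - 1] (mod int k)"
        from cong_mult[OF this cong_refl[of "int b"]] have "[int a = - 1 * int b] (mod int k)"
          using nb by (metis cong_sym cong_trans)
        moreover have "[- 1 * int b = int (k - b)] (mod int k)"
          using totatives_reflect(2)[OF k b] by (simp add: cong_iff_dvd_diff of_nat_diff)
        ultimately have "[int a = int (k - b)] (mod int k)" by (rule cong_trans)
        then show False
          using eq[of a "k - b"] 3 totatives_reflect(2)[OF k a]
            totatives_reflect(2)[OF k totatives_reflect(1)[OF k b]] by simp
      qed
    qed
    finally show ?thesis using 3 by simp
  qed
qed

text \<open>For a fixed odd \<open>\<rho>\<close>, the inner products of all odd
  \<open>\<psi>\<close> with \<open>\<rho>\<close> are summed in two ways. Orthogonality over
  residues leaves \<open>totient k\<close>; summing over \<open>\<psi>\<close> first leaves the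
  residues 1 and \<open>k - 1\<close>, each contributing the number of odd characters.\<close>

lemma card_odd_dirichlet_characters:
  assumes k: "k \<ge> 3"
  shows "2 * card (odd_dirichlet_characters k) = totient k"
proof -
  let ?O = "odd_dirichlet_characters k" and ?R = "totatives k"
  have k1: "k > 1" using k by simp
  have dc: "dirichlet_character k \<psi>" if "\<psi> \<in> ?O" for \<psi>
    using that by (simp add: odd_dirichlet_characters_def)
  obtain \<rho> where \<rho>: "\<rho> \<in> ?O" using odd_dirichlet_characters_nonempty[OF k] by blast
  have "of_nat (totient k) = (\<Sum>\<psi>\<in>?O. if \<psi> = \<rho> then of_nat (totient k) else (0::complex))"
    using \<rho> finite_odd_dirichlet_characters[of k] k by simp
  also have "\<dots> = (\<Sum>\<psi>\<in>?O. \<Sum>a\<in>?R. \<psi> (int a) * cnj (\<rho> (int a)))"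
    by (intro sum.cong refl dirichlet_character_orthogonal[OF k1 dc dc[OF \<rho>], symmetric])
  also have "\<dots> = (\<Sum>a\<in>?R. (\<Sum>\<psi>\<in>?O. \<psi> (int a)) * cnj (\<rho> (int a)))"
    unfolding sum_distrib_right by (rule sum.swap)
  also have "\<dots> = (\<Sum>a\<in>?R. of_nat (card ?O) * (if a = 1 then cnj (\<rho> (int a)) else 0) -
      of_nat (card ?O) * (if a = k - 1 then cnj (\<rho> (int a)) else 0))"
  proof (rule sum.cong[OF refl])
    fix a assume a: "a \<in> ?R"
    have "(\<Sum>\<psi>\<in>?O. \<psi> (int a)) = (\<Sum>\<psi>\<in>?O. \<psi> (int a) * cnj (\<psi> (int 1)))"
      by (intro sum.cong refl) (simp add: dirichlet_character_1[OF dc])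
    also have "\<dots> = of_nat (card ?O) * ((if a = 1 then 1 else 0) - (if a = k - 1 then 1 else 0))"
      using k by (intro sum_odd_dirichlet_characters_mult_cnj[OF k a]) simp
    finally show "(\<Sum>\<psi>\<in>?O. \<psi> (int a)) * cnj (\<rho> (int a)) =
      of_nat (card ?O) * (if a = 1 then cnj (\<rho> (int a)) else 0) -
      of_nat (card ?O) * (if a = k - 1 then cnj (\<rho> (int a)) else 0)"
      by simp
  qed
  also have "\<dots> = of_nat (card ?O) * (\<Sum>a\<in>?R. if a = 1 then cnj (\<rho> (int a)) else 0) -
      of_nat (card ?O) * (\<Sum>a\<in>?R. if a = k - 1 then cnj (\<rho> (int a)) else 0)"
    by (simp only: sum_subtractf sum_distrib_left)
  also have "(\<Sum>a\<in>?R. if a = 1 then cnj (\<rho> (int a)) else 0) = 1"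
    using k dirichlet_character_1[OF dc[OF \<rho>]] by (subst sum.delta) auto
  also have "(\<Sum>a\<in>?R. if a = k - 1 then cnj (\<rho> (int a)) else 0) = - 1"
    using k totatives_reflect(1)[OF k, of 1] dirichlet_character_1[OF dc[OF \<rho>]]
      odd_dirichlet_character_reflect[OF \<rho>, of 1]
    by (subst sum.delta) auto
  finally have "complex_of_nat (totient k) = of_nat (2 * card ?O)" by simp
  then show ?thesis by (simp only: of_nat_eq_iff)
qed

subsection \<open>The value at 3 for an odd character\<close>

lemma dirichlet_L_3_term:
  fixes \<psi> :: "int \<Rightarrow> complex"
  shows "\<psi> (int (Suc n)) * of_nat (Suc n) powr (- 3) = \<psi> (int (Suc n)) * of_real (1 / real (Suc n) ^ 3)"
proof -
  have "(of_nat (Suc n) :: complex) powr (- 3) = of_real (real (Suc n) powr (- 3))"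
    using powr_of_real[of "real (Suc n)" "- 3"] by simp
  also have "real (Suc n) powr (- 3) = 1 / real (Suc n) ^ 3"
    by (simp add: powr_minus powr_numeral inverse_eq_divide del: of_nat_Suc)
  finally show ?thesis by simp
qed

lemma dirichlet_L_3_residue_classes:
  assumes \<psi>: "dirichlet_character k \<psi>" and k: "k > 1"
  shows "dirichlet_L 3 \<psi> =
    (\<Sum>a\<in>totatives k. \<psi> (int a) * of_real (- Polygamma 2 (real a / real k) / (2 * real k ^ 3)))"
proof -
  define f where "f n = \<psi> (int (Suc n)) * of_real (1 / real (Suc n) ^ 3)" for n
  define S where "S a = - Polygamma 2 (real a / real k) / (2 * real k ^ 3)" for a
  \<comment> \<open>The majorant is the case of modulus 1 of the residue class sums. Its summability
    allows the series to be grouped into blocks of length \<open>k\<close>.\<close>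
  have "summable (\<lambda>n. 1 / real (n * 1 + 1) ^ 3)"
    by (rule sums_summable[OF cubic_residue_class_sums]) auto
  then have "summable f"
  proof (rule summable_comparison_test')
    fix n
    show "norm (f n) \<le> 1 / real (n * 1 + 1) ^ 3"
      using mult_right_mono[OF dirichlet_character_norm_le_1[OF \<psi>, of "int (Suc n)"], of "1 / real (Suc n) ^ 3"] k
      by (simp add: f_def norm_mult norm_divide norm_power del: of_nat_Suc)
  qed
  then have "f sums (\<Sum>n. f n)" by (rule summable_sums)
  also have "(\<Sum>n. f n) = dirichlet_L 3 \<psi>"
    unfolding dirichlet_L_def f_def dirichlet_L_3_term ..
  finally have 1: "(\<lambda>m. sum f {m * k..<m * k + k}) sums dirichlet_L 3 \<psi>"
    by (rule sums_group) (use k in simp)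
  have "sum f {m * k..<m * k + k} = (\<Sum>a\<in>totatives k. \<psi> (int a) * of_real (1 / real (m * k + a) ^ 3))" for m
  proof -
    \<comment> \<open>Index \<open>n\<close> stands for the integer \<open>n + 1\<close>, so block
      \<open>m\<close> covers \<open>m * k + 1\<close> to \<open>m * k + k\<close>.\<close>
    have "sum f {m * k..<m * k + k} = (\<Sum>a=1..k. f (m * k + a - 1))"
      by (rule sum.reindex_bij_witness[of _ "\<lambda>a. m * k + a - 1" "\<lambda>n. n + 1 - m * k"]) auto
    also have "\<dots> = (\<Sum>a=1..k. \<psi> (int a) * of_real (1 / real (m * k + a) ^ 3))"
    proof (rule sum.cong[OF refl])
      fix a assume "a \<in> {1..k}"
      then have *: "Suc (m * k + a - 1) = m * k + a" by simp
      have "[int (m * k + a) = int a] (mod int k)" by (simp add: cong_def)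
      then have "\<psi> (int (m * k + a)) = \<psi> (int a)" by (rule dirichlet_character_cong[OF \<psi>])
      then show "f (m * k + a - 1) = \<psi> (int a) * of_real (1 / real (m * k + a) ^ 3)"
        unfolding f_def * by simp
    qed
    also have "\<dots> = (\<Sum>a\<in>totatives k. \<psi> (int a) * of_real (1 / real (m * k + a) ^ 3))"
      by (rule sum.mono_neutral_right)
        (auto simp: in_totatives_iff dirichlet_character_eq_0_iff[OF \<psi>])
    finally show ?thesis .
  qed
  with 1 have "(\<lambda>m. \<Sum>a\<in>totatives k. \<psi> (int a) * of_real (1 / real (m * k + a) ^ 3)) sums dirichlet_L 3 \<psi>"
    by simp
  moreover have "(\<lambda>m. \<Sum>a\<in>totatives k. \<psi> (int a) * of_real (1 / real (m * k + a) ^ 3)) sums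
      (\<Sum>a\<in>totatives k. \<psi> (int a) * of_real (S a))"
    unfolding S_def using k
    by (intro sums_sum sums_mult sums_of_real cubic_residue_class_sums) (auto simp: in_totatives_iff)
  ultimately show ?thesis unfolding S_def by (rule sums_unique2)
qed

lemma dirichlet_L_3_odd:
  assumes \<psi>: "\<psi> \<in> odd_dirichlet_characters k" and k: "k \<ge> 3"
  shows "dirichlet_L 3 \<psi> = of_real (pi ^ 3 / (2 * real k ^ 3)) *
    (\<Sum>a\<in>totatives k. \<psi> (int a) *
      of_real (cos (pi * (real a / real k)) / sin (pi * (real a / real k)) ^ 3))"
proof -
  let ?R = "totatives k"
  define S where "S a = - Polygamma 2 (real a / real k) / (2 * real k ^ 3)" for a
  define w where "w a = cos (pi * (real a / real k)) / sin (pi * (real a / real k)) ^ 3" for a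
  have L: "dirichlet_L 3 \<psi> = (\<Sum>a\<in>?R. \<psi> (int a) * of_real (S a))"
    unfolding S_def using \<psi> k by (intro dirichlet_L_3_residue_classes) (auto simp: odd_dirichlet_characters_def)
  \<comment> \<open>Reindexing gives a second expression for the same value. Added to the first,
    with the sign from oddness, it produces the difference \<open>S a - S (k - a)\<close> that the
    reflection formula evaluates.\<close>
  also have "\<dots> = (\<Sum>a\<in>?R. \<psi> (int (k - a)) * of_real (S (k - a)))"
    by (rule sum.reindex_bij_witness[of _ "\<lambda>a. k - a" "\<lambda>a. k - a"])
      (auto simp: totatives_reflect[OF k] totatives_le)
  also have "\<dots> = (\<Sum>a\<in>?R. - \<psi> (int a) * of_real (S (k - a)))"
    by (intro sum.cong refl) (simp only: odd_dirichlet_character_reflect[OF \<psi> totatives_le])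
  finally have "2 * dirichlet_L 3 \<psi> =
      (\<Sum>a\<in>?R. \<psi> (int a) * of_real (S a)) + (\<Sum>a\<in>?R. - \<psi> (int a) * of_real (S (k - a)))"
    using L by simp
  also have "\<dots> = (\<Sum>a\<in>?R. \<psi> (int a) * of_real (S a - S (k - a)))"
    by (simp add: algebra_simps flip: sum.distrib)
  also have "\<dots> = (\<Sum>a\<in>?R. of_real (pi ^ 3 / real k ^ 3) * (\<psi> (int a) * of_real (w a)))"
  proof (rule sum.cong[OF refl])
    fix a assume a: "a \<in> ?R"
    let ?x = "real a / real k"
    have x: "0 < ?x" "?x < 1" using a totatives_reflect(2)[OF k a] by (auto simp: in_totatives_iff)
    have "real (k - a) / real k = 1 - ?x"
      using totatives_reflect(2)[OF k a] by (simp add: of_nat_diff field_simps)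
    then have "S a - S (k - a) = (Polygamma 2 (1 - ?x) - Polygamma 2 ?x) / (2 * real k ^ 3)"
      by (simp add: S_def diff_divide_distrib)
    also have "\<dots> = pi ^ 3 / real k ^ 3 * w a"
      unfolding Polygamma_2_reflection_real[OF x] w_def by simp
    finally show "\<psi> (int a) * of_real (S a - S (k - a)) =
        of_real (pi ^ 3 / real k ^ 3) * (\<psi> (int a) * of_real (w a))"
      by simp
  qed
  also have "\<dots> = 2 * (of_real (pi ^ 3 / (2 * real k ^ 3)) * (\<Sum>a\<in>?R. \<psi> (int a) * of_real (w a)))"
    unfolding sum_distrib_left[symmetric] by simp
  finally show ?thesis unfolding w_def by (subst (asm) mult_left_cancel) simp_all
qed

text \<open>In the double sum over \<open>a\<close> and \<open>b\<close>, only the pairs with \<open>b = a\<close> and \<open>b = k - a\<close> survive.\<close>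

lemma sum_odd_dirichlet_characters_norm_squared:
  fixes w :: "nat \<Rightarrow> real"
  assumes k: "k \<ge> 3" and w: "\<And>a. a \<in> totatives k \<Longrightarrow> w (k - a) = - w a"
  shows "(\<Sum>\<psi>\<in>odd_dirichlet_characters k. (cmod (\<Sum>a\<in>totatives k. \<psi> (int a) * of_real (w a)))\<^sup>2) =
    real (totient k) * (\<Sum>a\<in>totatives k. (w a)\<^sup>2)"
proof -
  let ?O = "odd_dirichlet_characters k" and ?R = "totatives k"
  have "complex_of_real (\<Sum>\<psi>\<in>?O. (cmod (\<Sum>a\<in>?R. \<psi> (int a) * of_real (w a)))\<^sup>2) =
      (\<Sum>\<psi>\<in>?O. \<Sum>a\<in>?R. \<Sum>b\<in>?R. of_real (w a * w b) * (\<psi> (int a) * cnj (\<psi> (int b))))"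
  proof (subst of_real_sum, rule sum.cong[OF refl])
    fix \<psi> :: "int \<Rightarrow> complex"
    let ?S = "\<Sum>a\<in>?R. \<psi> (int a) * of_real (w a)"
    have "of_real ((cmod ?S)\<^sup>2) = ?S * cnj ?S" by (rule complex_norm_square)
    also have "\<dots> = (\<Sum>a\<in>?R. \<Sum>b\<in>?R. (\<psi> (int a) * of_real (w a)) * cnj (\<psi> (int b) * of_real (w b)))"
      by (simp only: cnj_sum sum_product)
    also have "\<dots> = (\<Sum>a\<in>?R. \<Sum>b\<in>?R. of_real (w a * w b) * (\<psi> (int a) * cnj (\<psi> (int b))))"
      by (intro sum.cong refl) (simp add: mult_ac)
    finally show "of_real ((cmod ?S)\<^sup>2) = \<dots>" .
  qed
  also have "\<dots> = (\<Sum>a\<in>?R. \<Sum>b\<in>?R. \<Sum>\<psi>\<in>?O. of_real (w a * w b) * (\<psi> (int a) * cnj (\<psi> (int b))))"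
    by (rule trans[OF sum.swap], rule sum.cong[OF refl], rule sum.swap)
  \<comment> \<open>The sign at \<open>b = k - a\<close> is compensated by
    \<open>w (k - a) = - w a\<close>, so both surviving terms contribute
    \<open>(w a)\<^sup>2\<close>. The 2 then combines with the number of odd characters to give
    \<open>totient k\<close>.\<close>
  also have "\<dots> = (\<Sum>a\<in>?R. of_nat (card ?O) * of_real (2 * (w a)\<^sup>2))"
  proof (rule sum.cong[OF refl])
    fix a assume a: "a \<in> ?R"
    have "(\<Sum>b\<in>?R. \<Sum>\<psi>\<in>?O. of_real (w a * w b) * (\<psi> (int a) * cnj (\<psi> (int b)))) =
        (\<Sum>b\<in>?R. of_nat (card ?O) * (if b = a then of_real (w a * w b) else 0) -
          of_nat (card ?O) * (if b = k - a then of_real (w a * w b) else 0))"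
    proof (rule sum.cong[OF refl])
      fix b assume b: "b \<in> ?R"
      have "a = k - b \<longleftrightarrow> b = k - a"
        using totatives_reflect(2)[OF k a] totatives_reflect(2)[OF k b] by auto
      then show "(\<Sum>\<psi>\<in>?O. of_real (w a * w b) * (\<psi> (int a) * cnj (\<psi> (int b)))) =
        of_nat (card ?O) * (if b = a then of_real (w a * w b) else 0) -
        of_nat (card ?O) * (if b = k - a then of_real (w a * w b) else 0)"
        using sum_odd_dirichlet_characters_mult_cnj[OF k a b]
        by (auto simp flip: sum_distrib_left)
    qed
    also have "\<dots> = of_nat (card ?O) * (\<Sum>b\<in>?R. if b = a then of_real (w a * w b) else 0) -
        of_nat (card ?O) * (\<Sum>b\<in>?R. if b = k - a then of_real (w a * w b) else 0)"
      by (simp only: sum_subtractf sum_distrib_left)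
    also have "(\<Sum>b\<in>?R. if b = a then complex_of_real (w a * w b) else 0) = of_real (w a * w a)"
      using a by (subst sum.delta) auto
    also have "(\<Sum>b\<in>?R. if b = k - a then complex_of_real (w a * w b) else 0) = of_real (w a * w (k - a))"
      using totatives_reflect(1)[OF k a] by (subst sum.delta) auto
    finally show "(\<Sum>b\<in>?R. \<Sum>\<psi>\<in>?O. of_real (w a * w b) * (\<psi> (int a) * cnj (\<psi> (int b)))) =
        of_nat (card ?O) * of_real (2 * (w a)\<^sup>2)"
      using w[OF a] by (simp add: power2_eq_square)
  qed
  also have "\<dots> = of_real (real (2 * card ?O) * (\<Sum>a\<in>?R. (w a)\<^sup>2))"
    by (simp add: sum_distrib_left mult_ac)
  finally show ?thesis
    unfolding card_odd_dirichlet_characters[OF k] by (simp only: of_real_eq_iff)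
qed

section \<open>Combination of the L-values, orthogonality and the sum over totatives\<close>

theorem theorem3p1:
  fixes k :: nat
  assumes "k \<ge> 3"
  shows "(\<Sum>\<psi>\<in>odd_dirichlet_characters k. (cmod (dirichlet_L 3 \<psi>))\<^sup>2) =
           pi ^ 6 / (90 * real k ^ 6) * real (totient k) *
             (jordan_totient 6 k / 21 - jordan_totient 2 k)"
proof -
  define w where "w a = cos (pi * (real a / real k)) / sin (pi * (real a / real k)) ^ 3" for a
  have w: "w (k - a) = - w a" if a: "a \<in> totatives k" for a
  proof -
    have "pi * (real (k - a) / real k) = pi - pi * (real a / real k)"
      using assms totatives_le[OF a] by (simp add: of_nat_diff field_simps)
    then show ?thesis unfolding w_def by simp
  qed
  have "(\<Sum>\<psi>\<in>odd_dirichlet_characters k. (cmod (dirichlet_L 3 \<psi>))\<^sup>2) =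
      (\<Sum>\<psi>\<in>odd_dirichlet_characters k. (pi ^ 3 / (2 * real k ^ 3))\<^sup>2 *
        (cmod (\<Sum>a\<in>totatives k. \<psi> (int a) * of_real (w a)))\<^sup>2)"
  proof (rule sum.cong[OF refl])
    fix \<psi> assume \<psi>: "\<psi> \<in> odd_dirichlet_characters k"
    show "(cmod (dirichlet_L 3 \<psi>))\<^sup>2 = (pi ^ 3 / (2 * real k ^ 3))\<^sup>2 *
        (cmod (\<Sum>a\<in>totatives k. \<psi> (int a) * of_real (w a)))\<^sup>2"
      unfolding dirichlet_L_3_odd[OF \<psi> assms] w_def norm_mult norm_of_real power_mult_distrib by simp
  qed
  also have "\<dots> = (pi ^ 3 / (2 * real k ^ 3))\<^sup>2 * (real (totient k) * (\<Sum>a\<in>totatives k. (w a)\<^sup>2))"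
    unfolding sum_distrib_left[symmetric]
    by (simp only: sum_odd_dirichlet_characters_norm_squared[of k w, OF assms w])
  also have "(\<Sum>a\<in>totatives k. (w a)\<^sup>2) = 2 / 45 * (jordan_totient 6 k / 21 - jordan_totient 2 k)"
    unfolding w_def using assms by (intro sum_totatives_cot_csc_squares) simp
  also have "(pi ^ 3 / (2 * real k ^ 3))\<^sup>2 = pi ^ 6 / (4 * real k ^ 6)"
    by (simp add: power_divide power_mult_distrib flip: power_mult)
  also have "pi ^ 6 / (4 * real k ^ 6) * (t * (2 / 45 * y)) = pi ^ 6 / (90 * real k ^ 6) * t * y" for t y
    by simp
  finally show ?thesis .
qed

end
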